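(* Let $\Omega\subset\mathbb{R}^n$ be a bounded domain, let $u\in\mathrm{Lip}_0(\Omega)\setminus\{0\}$ be a minimizer of the Rayleigh quotient $R^\infty(u)=\|\nabla u\|_{L^\infty}/\|u\|_\infty$, and let $\nu,\tau\in\mathcal{M}_+(\Omega)$ satisfy $\lambda_\infty\nu u=-\operatorname{div}(\tau\nabla_\tau u)$ together with: $\nu(\Omega)=1/\|u\|_\infty$, $\tau(\Omega)=1/\|\nabla u\|_{L^\infty}$, $\nu(\Omega\setminus\omega_{\max}(u))=0$, $\tau(\Omega\setminus\Omega_{\max}(u))=0$, and $\langle\!\langle\nabla u,\sigma\rangle\!\rangle=\|\nabla u\|_{L^\infty}|\sigma|$ for $\sigma:=\tau\nabla_\tau u$. Then the probability measure $\mu:=\nu\|u\|_\infty$ satisfies $$\mu\in\operatorname*{arg\,max}_{\tilde\mu\in\mathcal{P}(\Omega)}\ \inf_{\delta\in\mathcal{P}(\partial\Omega)}W^1(\tilde\mu,\delta).$$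
   Context: $\mathrm{Lip}_0(\Omega)$: Lipschitz functions on $\overline\Omega$ vanishing on $\partial\Omega$; $\|\nabla u\|_{L^\infty}$ is the essential supremum of $|\nabla u|$ over $\Omega$, $\|u\|_\infty=\max|u|$. $\mathcal{M}(\Omega)$: finite signed Radon measures on $\Omega$; $\mathcal{M}_+(\Omega)$: the non-negative ones; $\mathcal{P}$: probability measures. $\lambda_\infty=\inf_{v\in\mathrm{Lip}_0(\Omega)\setminus\{0\}}\|\nabla v\|_{L^\infty}/\|v\|_\infty$, which equals $1/r_\Omega$ where $r_\Omega=\max_{x\in\Omega}\operatorname{dist}(x,\partial\Omega)$. For $\mu,\delta\in\mathcal{P}(\overline\Omega)$, the (geodesic) 1-Wasserstein distance is $W^1(\mu,\delta)=\sup\{\int u\,d\mu-\int u\,d\delta: u\in\mathrm{Lip}(\overline\Omega),\ \|\nabla u\|_{L^\infty}\le1\}$, where $\mathrm{Lip}(\overline\Omega)$ is the space of Lipschitz functions on $\overline\Omega$ and measures are regarded as measures on $\overline\Omega$. $\sigma\in\mathcal{M}(\Omega,\mathbb{R}^n)$ is a divergence-measure field, $\sigma\in\mathcal{DM}(\Omega,\mathbb{R}^n)$, with $\operatorname{div}\sigma:=\mu\in\mathcal{M}(\Omega)$, if $-\int_\Omega\nabla\varphi\cdot d\sigma=\int_\Omega\varphi\,d\mu$ for all $\varphi\in C_c^\infty(\Omega)$. $\omega_{\max}(u)=\{x\in\Omega:|u(x)|=\|u\|_\infty\}$. For $u\in\mathrm{Lip}_0(\Omega)$ consider sequences $\{u_k\}\subset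 C_c^\infty(\Omega)$ with ( * ) $\sup_k\max_\Omega|\nabla u_k|\le\|\nabla u\|_{L^\infty}$ and $\max_\Omega|u_k-u|\to0$. Then $\Omega_{\max}(u)=\{x\in\Omega:\limsup_k|\nabla u_k(x)|=\|\nabla u\|_{L^\infty}\}$ for any sequence satisfying ( * ) (read for an arbitrary choice of such a sequence). Tangential gradient: for $\mu\in\mathcal{M}_+(\Omega)$, let $N_\mu$ be the set of $\xi\in L^\infty_\mu(\Omega,\mathbb{R}^n)$ for which there is $\{v_k\}\subset C_c^\infty(\Omega)$ with $v_k\to0$ uniformly and $\nabla v_k\rightharpoonup^*\xi$ in $L^\infty_\mu$. The tangent space of $\mu$ is the ($\mu$-a.e. unique) $\mu$-measurable field of linear subspaces $T_\mu(x)\subset\mathbb{R}^n$ such that $\theta\in L^1_\mu(\Omega,\mathbb{R}^n)$ satisfies $\int\theta\cdot\xi\,d\mu=0$ for all $\xi\in N_\mu$ iff $\theta(x)\in T_\mu(x)$ for $\mu$-a.e. $x$. $P_\mu(x,\cdot)$ is the orthogonal projection onto $T_\mu(x)$; $\nabla_\mu u$ is the weak$^*$ limit in $L^\infty_\mu$ of $P_\mu(\cdot,\nabla u_k(\cdot))$ for any sequence satisfying ( * ) (it exists and is independent of the sequence). Pairing: for $u\in\mathrm{Lip}_0(\Omega)$, $\sigma\in\mathcal{DM}(\Omega,\mathbb{R}^n)$, $\langle\!\langle\nabla u,\sigma\rangle\!\rangle\in\mathcal{M}(\Omega)$ is the signed measure with $\int\varphi\,d\langle\!\langle\nabla u,\sigma\rangle\!\rangle=-\int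 u\varphi\,d\operatorname{div}\sigma-\int u\nabla\varphi\cdot d\sigma$ for all $\varphi\in C_c^\infty(\Omega)$. *)

theory Defs
  imports "HOL-Probability.Probability" "HOL-Library.Disjoint_Sets"
begin

section \<open>Smooth and Lipschitz functions\<close>

text \<open>The value \<open>0\<close> at points of non-differentiability is a convention; for a Lipschitz
  function these points form a Lebesgue null set (Rademacher).\<close>

definition grad :: "('a::euclidean_space \<Rightarrow> real) \<Rightarrow> 'a \<Rightarrow> 'a" where
  "grad f x = (if \<exists>D. GDERIV f x :> D then (THE D. GDERIV f x :> D) else 0)"

primrec Ck :: "nat \<Rightarrow> ('a::euclidean_space \<Rightarrow> real) \<Rightarrow> bool" where
  "Ck 0 f = continuous_on UNIV f"
| "Ck (Suc k) f =
    (\<exists>g. (\<forall>x. GDERIV f x :> g x) \<and> (\<forall>b\<in>Basis. Ck k (\<lambda>x. g x \<bullet> b)))"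

text \<open>Elements of \<open>C\<^sub>c\<^sup>\<infinity>(\<Omega>)\<close> are identified with their extensions by zero to the whole space.\<close>

definition Cc_inf :: "'a::euclidean_space set \<Rightarrow> ('a \<Rightarrow> real) set" where
  "Cc_inf \<Omega> = {\<phi>. (\<forall>k. Ck k \<phi>) \<and> compact (closure {x. \<phi> x \<noteq> 0})
                   \<and> closure {x. \<phi> x \<noteq> 0} \<subseteq> \<Omega>}"

text \<open>Functions on \<open>closure \<Omega>\<close> are total functions whose values off \<open>closure \<Omega>\<close> are irrelevant,
  so integrals of such functions are written below as set integrals.\<close>

definition Lip :: "'a::euclidean_space set \<Rightarrow> ('a \<Rightarrow> real) set" where
  "Lip \<Omega> = {u. \<exists>L. L-lipschitz_on (closure \<Omega>) u}"

definition Lip0 :: "'a::euclidean_space set \<Rightarrow> ('a \<Rightarrow> real) set" where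
  "Lip0 \<Omega> = {u \<in> Lip \<Omega>. \<forall>x\<in>frontier \<Omega>. u x = 0}"

definition Lip0_nonzero :: "'a::euclidean_space set \<Rightarrow> ('a \<Rightarrow> real) set" where
  "Lip0_nonzero \<Omega> = {u \<in> Lip0 \<Omega>. \<exists>x\<in>\<Omega>. u x \<noteq> 0}"

definition sup_norm :: "'a::euclidean_space set \<Rightarrow> ('a \<Rightarrow> real) \<Rightarrow> real" where
  "sup_norm \<Omega> u = (SUP x\<in>closure \<Omega>. \<bar>u x\<bar>)"

definition grad_norm :: "'a::euclidean_space set \<Rightarrow> ('a \<Rightarrow> real) \<Rightarrow> real" where
  "grad_norm \<Omega> u = real_of_ereal (esssup (lebesgue_on \<Omega>) (\<lambda>x. ereal (norm (grad u x))))"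

definition rayleigh :: "'a::euclidean_space set \<Rightarrow> ('a \<Rightarrow> real) \<Rightarrow> real" where
  "rayleigh \<Omega> u = grad_norm \<Omega> u / sup_norm \<Omega> u"

definition lambda_inf :: "'a::euclidean_space set \<Rightarrow> real" where
  "lambda_inf \<Omega> = (INF v\<in>Lip0_nonzero \<Omega>. rayleigh \<Omega> v)"

definition omega_max :: "'a::euclidean_space set \<Rightarrow> ('a \<Rightarrow> real) \<Rightarrow> 'a set" where
  "omega_max \<Omega> u = {x\<in>\<Omega>. \<bar>u x\<bar> = sup_norm \<Omega> u}"

definition approx_seq ::
  "'a::euclidean_space set \<Rightarrow> ('a \<Rightarrow> real) \<Rightarrow> (nat \<Rightarrow> 'a \<Rightarrow> real) \<Rightarrow> bool" where
  "approx_seq \<Omega> u U \<longleftrightarrow>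
     (\<forall>k. U k \<in> Cc_inf \<Omega>) \<and>
     (\<forall>k. \<forall>x\<in>\<Omega>. norm (grad (U k) x) \<le> grad_norm \<Omega> u) \<and>
     uniform_limit \<Omega> U u sequentially"

text \<open>\<open>\<Omega>\<^sub>m\<^sub>a\<^sub>x(u)\<close> computed from the approximating sequence \<open>U\<close>.\<close>

definition Omega_max ::
  "'a::euclidean_space set \<Rightarrow> ('a \<Rightarrow> real) \<Rightarrow> (nat \<Rightarrow> 'a \<Rightarrow> real) \<Rightarrow> 'a set" where
  "Omega_max \<Omega> u U =
     {x\<in>\<Omega>. limsup (\<lambda>k. ereal (norm (grad (U k) x))) = ereal (grad_norm \<Omega> u)}"

section \<open>Measures\<close>

text \<open>A measure on a Borel set \<open>S\<close> (below: \<open>\<Omega>\<close>, its closure or its boundary) is a Borel measure on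
  the whole space that vanishes off \<open>S\<close>. This makes a measure on \<open>\<Omega>\<close> or on the boundary literally
  a measure on the closure. Finite Borel measures on a Euclidean space are Radon.\<close>

definition finite_measures_on :: "'a::euclidean_space set \<Rightarrow> 'a measure set" where
  "finite_measures_on S = {\<mu>. sets \<mu> = sets borel \<and> finite_measure \<mu> \<and> emeasure \<mu> (- S) = 0}"

definition prob_measures_on :: "'a::euclidean_space set \<Rightarrow> 'a measure set" where
  "prob_measures_on S = {\<mu> \<in> finite_measures_on S. prob_space \<mu>}"

text \<open>The supremum is extended-real valued: the geodesic distance of an arbitrary bounded domain
  may be unbounded.\<close>

definition W1 :: "'a::euclidean_space set \<Rightarrow> 'a measure \<Rightarrow> 'a measure \<Rightarrow> ereal" where
  "W1 \<Omega> \<mu> \<delta> =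
     (SUP u\<in>{u \<in> Lip \<Omega>. grad_norm \<Omega> u \<le> 1}.
        ereal ((LINT x:closure \<Omega>|\<mu>. u x) - (LINT x:closure \<Omega>|\<delta>. u x)))"

text \<open>Finite signed (\<open>'b = real\<close>) and vector-valued Radon measures are countably additive set
  functions; only their values on Borel sets matter.\<close>

definition vector_measure_on ::
  "'a::euclidean_space set \<Rightarrow> ('a set \<Rightarrow> 'b::euclidean_space) \<Rightarrow> bool" where
  "vector_measure_on \<Omega> \<sigma> \<longleftrightarrow>
     (\<forall>A. range A \<subseteq> sets borel \<longrightarrow> disjoint_family A \<longrightarrow>
        (\<lambda>i. \<sigma> (A i)) sums \<sigma> (\<Union>i::nat. A i)) \<and>
     (\<forall>A\<in>sets borel. \<sigma> A = \<sigma> (A \<inter> \<Omega>))"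

definition pos_variation :: "('a::euclidean_space set \<Rightarrow> real) \<Rightarrow> 'a measure" where
  "pos_variation \<mu> =
     measure_of UNIV (sets borel) (\<lambda>A. SUP B\<in>{B\<in>sets borel. B \<subseteq> A}. ennreal (\<mu> B))"

definition total_variation :: "('a::euclidean_space set \<Rightarrow> 'b::euclidean_space) \<Rightarrow> 'a set \<Rightarrow> real" where
  "total_variation \<sigma> A =
     (SUP P\<in>{P. finite P \<and> partition_on A P \<and> P \<subseteq> sets borel}. \<Sum>E\<in>P. norm (\<sigma> E))"

text \<open>Integration against a signed measure through its Jordan decomposition, and of a vector field
  against a vector measure by components.\<close>

definition signed_integral :: "('a::euclidean_space set \<Rightarrow> real) \<Rightarrow> ('a \<Rightarrow> real) \<Rightarrow> real" where
  "signed_integral \<mu> f =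
     integral\<^sup>L (pos_variation \<mu>) f - integral\<^sup>L (pos_variation (\<lambda>A. - \<mu> A)) f"

definition vector_integral :: "('a::euclidean_space set \<Rightarrow> 'a) \<Rightarrow> ('a \<Rightarrow> 'a) \<Rightarrow> real" where
  "vector_integral \<sigma> F = (\<Sum>b\<in>Basis. signed_integral (\<lambda>A. \<sigma> A \<bullet> b) (\<lambda>x. F x \<bullet> b))"

text \<open>\<open>\<sigma>\<close> is a divergence-measure field on \<open>\<Omega>\<close> with \<open>div \<sigma> = \<mu>\<close>.\<close>

definition has_divergence ::
  "'a::euclidean_space set \<Rightarrow> ('a set \<Rightarrow> 'a) \<Rightarrow> ('a set \<Rightarrow> real) \<Rightarrow> bool" where
  "has_divergence \<Omega> \<sigma> \<mu> \<longleftrightarrow>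
     vector_measure_on \<Omega> \<sigma> \<and> vector_measure_on \<Omega> \<mu> \<and>
     (\<forall>\<phi>\<in>Cc_inf \<Omega>. - vector_integral \<sigma> (grad \<phi>) = signed_integral \<mu> \<phi>)"

text \<open>\<open>\<pi>\<close> is the pairing of \<open>\<nabla>u\<close> and \<open>\<sigma>\<close>. Both \<open>\<mu> = div \<sigma>\<close> and \<open>\<pi>\<close> are determined on Borel sets
  by their integrals against test functions.\<close>

definition is_pairing ::
  "'a::euclidean_space set \<Rightarrow> ('a \<Rightarrow> real) \<Rightarrow> ('a set \<Rightarrow> 'a) \<Rightarrow> ('a set \<Rightarrow> real) \<Rightarrow> bool" where
  "is_pairing \<Omega> u \<sigma> \<pi> \<longleftrightarrow>
     vector_measure_on \<Omega> \<pi> \<and>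
     (\<exists>\<mu>. has_divergence \<Omega> \<sigma> \<mu> \<and>
        (\<forall>\<phi>\<in>Cc_inf \<Omega>. signed_integral \<pi> \<phi> =
            - signed_integral \<mu> (\<lambda>x. u x * \<phi> x) - vector_integral \<sigma> (\<lambda>x. u x *\<^sub>R grad \<phi> x)))"

section \<open>Tangential gradient\<close>

text \<open>Elements of \<open>L\<^sup>1\<^sub>\<mu>\<close>, \<open>L\<^sup>\<infinity>\<^sub>\<mu>\<close> and \<open>\<mu>\<close>-measurable fields of subspaces are handled through Borel
  representatives.\<close>

definition Linf :: "'a::euclidean_space measure \<Rightarrow> ('a \<Rightarrow> 'a) set" where
  "Linf \<mu> = {\<xi> \<in> borel_measurable \<mu>. \<exists>C. AE x in \<mu>. norm (\<xi> x) \<le> C}"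

definition weak_star_lim ::
  "'a::euclidean_space measure \<Rightarrow> (nat \<Rightarrow> 'a \<Rightarrow> 'a) \<Rightarrow> ('a \<Rightarrow> 'a) \<Rightarrow> bool" where
  "weak_star_lim \<mu> F \<xi> \<longleftrightarrow>
     (\<forall>k. F k \<in> Linf \<mu>) \<and> \<xi> \<in> Linf \<mu> \<and>
     (\<forall>\<psi>. integrable \<mu> \<psi> \<longrightarrow>
        (\<lambda>k. LINT x|\<mu>. F k x \<bullet> \<psi> x) \<longlonglongrightarrow> (LINT x|\<mu>. \<xi> x \<bullet> \<psi> x))"

definition N_space :: "'a::euclidean_space set \<Rightarrow> 'a measure \<Rightarrow> ('a \<Rightarrow> 'a) set" where
  "N_space \<Omega> \<mu> =
     {\<xi> \<in> Linf \<mu>. \<exists>v. (\<forall>k. v k \<in> Cc_inf \<Omega>) \<and> uniform_limit \<Omega> v (\<lambda>x. 0) sequentially \<and>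
                       weak_star_lim \<mu> (\<lambda>k. grad (v k)) \<xi>}"

definition is_tangent_space ::
  "'a::euclidean_space set \<Rightarrow> 'a measure \<Rightarrow> ('a \<Rightarrow> 'a set) \<Rightarrow> bool" where
  "is_tangent_space \<Omega> \<mu> T \<longleftrightarrow>
     (\<forall>x. subspace (T x)) \<and>
     (\<forall>G. open G \<longrightarrow> {x. T x \<inter> G \<noteq> {}} \<in> sets \<mu>) \<and>
     (\<forall>\<theta>. integrable \<mu> \<theta> \<longrightarrow>
        ((\<forall>\<xi>\<in>N_space \<Omega> \<mu>. (LINT x|\<mu>. \<theta> x \<bullet> \<xi> x) = 0) \<longleftrightarrow> (AE x in \<mu>. \<theta> x \<in> T x)))"

definition orth_proj :: "'a::euclidean_space set \<Rightarrow> 'a \<Rightarrow> 'a" where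
  "orth_proj S v = (THE p. p \<in> S \<and> (\<forall>w\<in>S. orthogonal (v - p) w))"

text \<open>\<open>g\<close> represents \<open>\<nabla>\<^sub>\<mu> u\<close>. The tangent space is unique almost everywhere and the limit does not
  depend on the approximating sequence, so quantifying existentially over both is harmless.\<close>

definition is_tangential_gradient ::
  "'a::euclidean_space set \<Rightarrow> 'a measure \<Rightarrow> ('a \<Rightarrow> real) \<Rightarrow> ('a \<Rightarrow> 'a) \<Rightarrow> bool" where
  "is_tangential_gradient \<Omega> \<mu> u g \<longleftrightarrow>
     (\<exists>T U. is_tangent_space \<Omega> \<mu> T \<and> approx_seq \<Omega> u U \<and>
        weak_star_lim \<mu> (\<lambda>k x. orth_proj (T x) (grad (U k) x)) g)"

end

theory Submission
  imports Defs
begin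

text \<open>Let \<open>d\<close> be the distance to the boundary of \<open>\<Omega>\<close> and \<open>R\<close> its maximum, the inradius. The transport
  distance from a probability measure on \<open>\<Omega>\<close> to the boundary is at most \<open>R\<close> for every measure, and
  it is at least \<open>R\<close> for a measure concentrated on points with \<open>d = R\<close>. The measure in question is
  of the latter kind.

  For the upper bound (\<open>W1_boundary_upper_bound\<close>) every point is moved to a boundary point that is nearest up
  to \<open>\<epsilon>\<close>: along a path that meets the boundary only at its end and has length at most \<open>R + \<epsilon>\<close> a test function
  with gradient at most \<open>1\<close> changes by at most that length (\<open>increment_le_grad_norm\<close>). For the lower bound (\<open>W1_boundary_lower_bound\<close>) the function \<open>d\<close> itself is the test
  function. Finally (\<open>inradius_le_at_maximum\<close>) let \<open>x\<close> be a point where a minimizer \<open>u\<close> attains its maximum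
  modulus. Moving from \<open>x\<close> to its nearest boundary point shows \<open>sup_norm \<Omega> u \<le> grad_norm \<Omega> u * d x\<close>,
  and comparison of the Rayleigh quotients of \<open>u\<close> and \<open>d\<close> shows \<open>grad_norm \<Omega> u * R \<le> sup_norm \<Omega> u\<close>; hence
  \<open>d x = R\<close>.

  The analytic core is the step from an almost everywhere bound on the classical gradient to a bound
  on increments. Since \<open>grad\<close> is set to \<open>0\<close> at points of non-differentiability, this rests on Rademacher's
  theorem, whose proof combines almost everywhere differentiability on
  lines with the fact that porous sets are null: at almost every \<open>x\<close> the set of points with
  approximately the same directional slope is so rich near \<open>x\<close> that the slope may be used at all
  nearby base points, and telescoping along the coordinate directions gives full differentiability.\<close>

section \<open>Lipschitz functions of one real variable\<close>

lemma AE_negligible: "negligible N \<Longrightarrow> AE x in lborel. x \<notin> N"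
  by (metis AE_completion_iff AE_not_in negligible_iff_null_sets)

lemma negligible_lipschitz_image:
  fixes f :: "'a::euclidean_space \<Rightarrow> 'a"
  assumes "negligible N" and lip: "L-lipschitz_on UNIV f"
  shows "negligible (f ` N)"
  using assms(1)
proof (rule negligible_locally_Lipschitz_image[rotated])
  fix x
  show "\<exists>T B. open T \<and> x \<in> T \<and> (\<forall>y\<in>N \<inter> T. norm (f y - f x) \<le> B * norm (y - x))"
    using lipschitz_onD[OF lip] by (intro exI[of _ UNIV] exI[of _ L]) (auto simp: dist_norm)
qed simp

text \<open>The inverse \<open>G\<close> of \<open>F\<close> exists because \<open>F\<close> grows at least as fast as the identity. The image of Lebesgue
  measure under \<open>G\<close> gives \<open>{a..b}\<close> the mass \<open>F b - F a\<close>, and it is absolutely continuous because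
  \<open>F\<close> maps null sets to null sets; the integrand is its Radon--Nikodym density.\<close>

lemma expanding_function_integral_representation:
  fixes F :: "real \<Rightarrow> real"
  assumes lip: "L-lipschitz_on UNIV F"
    and exp: "\<And>x y. x \<le> y \<Longrightarrow> y - x \<le> F y - F x"
  obtains g where "\<And>a b. a \<le> b \<Longrightarrow> (g has_integral (F b - F a)) {a..b}"
proof -
  have cont: "continuous_on A F" for A
    using lipschitz_on_continuous_on[OF lip] continuous_on_subset by blast
  have le_iff: "F x \<le> F y \<longleftrightarrow> x \<le> y" for x y
    using exp[of x y] exp[of y x] by linarith
  have inj: "inj F"
    by (rule injI) (metis le_iff order_antisym order_refl)
  have "\<exists>x. F x = y" for y
  proof -
    define c where "c = \<bar>y - F 0\<bar>"
    have "F (-c) \<le> y" "y \<le> F c"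
      using exp[of "-c" 0] exp[of 0 c] by (auto simp: c_def)
    then show ?thesis
      using IVT'[of F "-c" y c] cont by (auto simp: c_def)
  qed
  then have surj: "surj F"
    by (metis surjI)
  define G where "G = inv F"
  have FG [simp]: "F (G y) = y" and GF [simp]: "G (F x) = x" for x y
    using surj inj by (auto simp: G_def surj_f_inv_f)
  have "1-lipschitz_on UNIV G"
  proof (rule lipschitz_onI)
    fix x y
    show "dist (G x) (G y) \<le> 1 * dist x y"
      using exp[of "G x" "G y"] exp[of "G y" "G x"] linear[of "G x" "G y"] by (auto simp: dist_real_def)
  qed simp
  then have G [measurable]: "G \<in> borel_measurable borel"
    by (metis borel_measurable_continuous_onI lipschitz_on_continuous_on)
  define M where "M = distr lborel borel G"
  have sets_M: "sets M = sets lborel"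
    by (simp add: M_def)
  have vim: "G -` N = F ` N" for N
    by (force simp: image_iff)
  have ac: "absolutely_continuous lborel M"
    unfolding absolutely_continuous_def
  proof
    fix N :: "real set" assume N: "N \<in> null_sets lborel"
    then have [measurable]: "N \<in> sets borel" by auto
    have "negligible N"
      using N by (metis negligible_iff_null_sets null_sets_completionI)
    then have "negligible (F ` N)"
      using lip by (rule negligible_lipschitz_image)
    then have "emeasure lborel (G -` N) = 0"
      by (metis vim G \<open>N \<in> sets borel\<close> measurable_sets_borel negligible_iff_null_sets null_setsD1
            null_sets_completion_iff sets_lborel)
    then show "N \<in> null_sets M"
      by (auto simp: M_def null_sets_def emeasure_distr)
  qed
  define h where "h = RN_deriv lborel M"
  have [measurable]: "h \<in> borel_measurable borel"
    unfolding h_def using borel_measurable_RN_deriv[of lborel M] by simp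
  have dens: "density lborel h = M"
    unfolding h_def by (rule sigma_finite_measure.density_RN_deriv[OF sigma_finite_lborel ac sets_M])
  have h_int: "(\<integral>\<^sup>+x\<in>{a..b}. h x \<partial>lborel) = ennreal (F b - F a)" if "a \<le> b" for a b
  proof -
    have "(\<integral>\<^sup>+x\<in>{a..b}. h x \<partial>lborel) = emeasure M {a..b}"
      by (subst dens[symmetric]) (simp add: emeasure_density)
    also have "\<dots> = emeasure lborel (G -` {a..b})"
      by (simp add: M_def emeasure_distr)
    also have "G -` {a..b} = {F a..F b}"
    proof -
      have "a \<le> G y \<longleftrightarrow> F a \<le> y" "G y \<le> b \<longleftrightarrow> y \<le> F b" for y
        using le_iff[of a "G y"] le_iff[of "G y" b] by simp_all
      then show ?thesis by auto
    qed
    also have "emeasure lborel {F a..F b} = ennreal (F b - F a)"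
      using that by (simp add: le_iff)
    finally show ?thesis .
  qed
  define g where "g x = enn2real (h x)" for x
  have "(g has_integral (F b - F a)) {a..b}" if ab: "a \<le> b" for a b
  proof -
    have "AE x in lborel. h x * indicator {a..b} x \<noteq> \<infinity>"
      using h_int[OF ab] by (intro nn_integral_PInf_AE) auto
    then have "(\<integral>\<^sup>+x. ennreal (g x * indicator {a..b} x) \<partial>lborel) = (\<integral>\<^sup>+x\<in>{a..b}. h x \<partial>lborel)"
      by (intro nn_integral_cong_AE)
         (auto elim!: eventually_mono simp: g_def indicator_def less_top split: if_splits)
    then have "((\<lambda>x. g x * indicator {a..b} x) has_integral (F b - F a)) UNIV"
      using ab h_int[OF ab] by (intro nn_integral_has_integral) (auto simp: g_def le_iff)
    then show ?thesis
      using has_integral_restrict_UNIV[of "{a..b}" g] by (simp add: indicator_def of_bool_def if_distrib cong: if_cong)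
  qed
  then show ?thesis
    using that by blast
qed

text \<open>After adding a linear function \<open>\<phi>\<close> becomes expanding, hence is the integral of some \<open>g\<close>. Lebesgue
  differentiation over the one-sided intervals \<open>[x, x + h]\<close> identifies the right derivative of \<open>\<phi>\<close>
  with \<open>g\<close> almost everywhere; the same theorem for the reflected function \<open>x \<mapsto> g (- x)\<close> does so for
  the left derivative.\<close>

lemma lipschitz_real_differentiable_ae:
  fixes \<phi> :: "real \<Rightarrow> real"
  assumes lip: "L-lipschitz_on UNIV \<phi>"
  obtains g N where "\<And>a b. a \<le> b \<Longrightarrow> (g has_integral (\<phi> b - \<phi> a)) {a..b}"
    and "negligible N" and "\<And>x. x \<notin> N \<Longrightarrow> (\<phi> has_real_derivative g x) (at x)"
proof -
  have d: "\<bar>\<phi> x - \<phi> y\<bar> \<le> L * \<bar>x - y\<bar>" for x y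
    using lipschitz_onD[OF lip, of x y] by (simp add: dist_real_def)
  have L: "L \<ge> 0" using lip by (rule lipschitz_on_nonneg)
  \<comment> \<open>The function \<open>\<phi>\<close> decreases at rate at most \<open>L\<close>, so the slope \<open>L + 1\<close> leaves growth at rate at least \<open>1\<close>.\<close>
  have "(L + (L + 1))-lipschitz_on UNIV (\<lambda>x. \<phi> x + (L + 1) * x)"
    using L by (intro lipschitz_on_add lip) (auto intro!: lipschitz_onI simp: dist_real_def abs_mult simp flip: right_diff_distrib)
  moreover have "y - x \<le> (\<phi> y + (L + 1) * y) - (\<phi> x + (L + 1) * x)" if "x \<le> y" for x y
    using d[of x y] that by (auto simp: algebra_simps abs_if split: if_splits)
  ultimately obtain g0 where
    g0: "\<And>a b. a \<le> b \<Longrightarrow> (g0 has_integral ((\<phi> b + (L + 1) * b) - (\<phi> a + (L + 1) * a))) {a..b}"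
    using expanding_function_integral_representation by blast
  define g where "g x = g0 x - (L + 1)" for x
  have g: "(g has_integral (\<phi> b - \<phi> a)) {a..b}" if "a \<le> b" for a b
    using has_integral_diff[OF g0[OF that] has_integral_const_real[of "L+1" a b]] that
    by (simp add: g_def[abs_def] algebra_simps)
  have reflect: "((\<lambda>x. g (-x)) has_integral (\<phi> (-a) - \<phi> (-b))) {a..b}" if "a \<le> b" for a b
    using g[of "-b" "-a"] that has_integral_reflect_real[of g _ "-a" "-b"] by simp
  have int: "g integrable_on cbox a b" "(\<lambda>x. g (-x)) integrable_on cbox a b" for a b
    by (cases "a \<le> b"; use g[of a b] reflect[of a b] in \<open>force simp: integrable_on_def intro: has_integral_empty_eq\<close>)+
  obtain N1 where N1: "negligible N1"
    "\<And>x e. \<lbrakk>x \<notin> N1; 0 < e\<rbrakk> \<Longrightarrow> \<exists>d>0. \<forall>h. 0 < h \<and> h < d \<longrightarrow>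
       norm (integral (cbox x (x + h *\<^sub>R One)) g /\<^sub>R h ^ DIM(real) - g x) < e"
    using integrable_ccontinuous_explicit[OF int(1)] by metis
  obtain N2 where N2: "negligible N2"
    "\<And>x e. \<lbrakk>x \<notin> N2; 0 < e\<rbrakk> \<Longrightarrow> \<exists>d>0. \<forall>h. 0 < h \<and> h < d \<longrightarrow>
       norm (integral (cbox x (x + h *\<^sub>R One)) (\<lambda>x. g (-x)) /\<^sub>R h ^ DIM(real) - g (-x)) < e"
    using integrable_ccontinuous_explicit[OF int(2)] by metis
  have "(\<phi> has_real_derivative g x) (at x)" if x: "x \<notin> N1" "- x \<notin> N2" for x
    unfolding DERIV_def LIM_eq
  proof (intro allI impI)
    fix e :: real assume "e > 0"
    obtain d1 where d1: "d1 > 0" "\<And>h. 0 < h \<Longrightarrow> h < d1 \<Longrightarrow> \<bar>(\<phi> (x + h) - \<phi> x) / h - g x\<bar> < e"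
      using N1(2)[OF x(1) \<open>e > 0\<close>] g[THEN integral_unique, of x "x + _"] by (auto simp: divide_inverse_commute)
    obtain d2 where d2: "d2 > 0" "\<And>h. 0 < h \<Longrightarrow> h < d2 \<Longrightarrow> \<bar>(\<phi> x - \<phi> (x - h)) / h - g x\<bar> < e"
      using N2(2)[OF x(2) \<open>e > 0\<close>] reflect[THEN integral_unique, of "-x" "-x + _"] by (auto simp: divide_inverse_commute)
    have "\<bar>(\<phi> (x + h) - \<phi> x) / h - g x\<bar> < e" if "h \<noteq> 0" "\<bar>h\<bar> < min d1 d2" for h
    proof (cases "h > 0")
      case True
      then show ?thesis using d1(2) that by auto
    next
      case False
      then show ?thesis using d2(2)[of "-h"] that by (auto simp: diff_divide_distrib)
    qed
    then show "\<exists>s>0. \<forall>h. h \<noteq> 0 \<and> norm (h - 0) < s \<longrightarrow> norm ((\<phi> (x + h) - \<phi> x) / h - g x) < e"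
      using d1(1) d2(1) by (intro exI[of _ "min d1 d2"]) auto
  qed
  moreover have "negligible (N1 \<union> uminus ` N2)"
    using N1 N2 negligible_lipschitz_image[of N2 1 uminus] by (simp add: lipschitz_on_def dist_real_def)
  ultimately show ?thesis
    using g that[of g "N1 \<union> uminus ` N2"] by (metis UnI1 UnI2 add.inverse_inverse imageI)
qed

text \<open>A Lipschitz function is the integral of its derivative, so an almost everywhere bound on the
  derivative controls increments.\<close>

lemma lipschitz_real_increment_bound:
  fixes \<phi> :: "real \<Rightarrow> real"
  assumes lip: "L-lipschitz_on UNIV \<phi>" and "a \<le> b"
    and C: "AE t in lborel. a \<le> t \<and> t \<le> b \<longrightarrow> (\<exists>D. (\<phi> has_real_derivative D) (at t) \<and> \<bar>D\<bar> \<le> C)"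
    and "C \<ge> 0"
  shows "\<bar>\<phi> b - \<phi> a\<bar> \<le> C * (b - a)"
proof -
  obtain g N where g: "\<And>a b. a \<le> b \<Longrightarrow> (g has_integral (\<phi> b - \<phi> a)) {a..b}"
    and N: "negligible N" "\<And>x. x \<notin> N \<Longrightarrow> (\<phi> has_real_derivative g x) (at x)"
    using lipschitz_real_differentiable_ae[OF lip] by blast
  obtain N' where N': "N' \<in> null_sets lborel"
    "\<And>t. t \<notin> N' \<Longrightarrow> a \<le> t \<and> t \<le> b \<longrightarrow> (\<exists>D. (\<phi> has_real_derivative D) (at t) \<and> \<bar>D\<bar> \<le> C)"
    using C by (auto elim: AE_E3)
  have "negligible (N \<union> N')"
    using N N' by (metis negligible_Un negligible_iff_null_sets null_sets_completionI)
  then have "((\<lambda>t. if t \<in> N \<union> N' then 0 else g t) has_integral (\<phi> b - \<phi> a)) {a..b}"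
    by (rule has_integral_spike[OF _ _ g[OF \<open>a \<le> b\<close>]]) auto
  then have "norm (\<phi> b - \<phi> a) \<le> C * Henstock_Kurzweil_Integration.content {a..b}"
  proof (rule has_integral_bound_real[OF \<open>C \<ge> 0\<close> finite.emptyI])
    fix t assume "t \<in> {a..b} - {}"
    then show "norm (if t \<in> N \<union> N' then 0 else g t) \<le> C"
      using N'(2)[of t] N(2)[of t] DERIV_unique \<open>C \<ge> 0\<close> by fastforce
  qed
  then show ?thesis
    using \<open>a \<le> b\<close> by simp
qed

section \<open>Null sets: sections along lines and porous sets\<close>

text \<open>Fubini without coordinates: by translation invariance the set of pairs \<open>(x, t)\<close> with
  \<open>x + t *\<^sub>R v \<in> A\<close> has null sections in the \<open>x\<close> direction exactly when \<open>A\<close> is null.\<close>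

lemma AE_on_lines_iff:
  fixes v :: "'a::euclidean_space"
  assumes A [measurable]: "A \<in> sets borel"
  shows "(AE x in lborel. AE t in lborel. x + t *\<^sub>R v \<notin> A) \<longleftrightarrow> (AE x in lborel. x \<notin> A)"
proof -
  have "(AE x in lborel. AE t in lborel. x + t *\<^sub>R v \<notin> A) \<longleftrightarrow>
        (AE t::real in lborel. AE x in lborel. x + t *\<^sub>R v \<notin> A)"
    by (rule lborel_pair.AE_commute) measurable
  also have "\<dots> \<longleftrightarrow> (AE t::real in lborel. AE x in lborel. x \<notin> A)"
  proof -
    have "(AE x in lborel. x + c \<notin> A) \<longleftrightarrow> (AE x in lborel. x \<notin> A)" for c :: 'a
    proof -
      have eq: "distr lborel borel (\<lambda>x. x + c) = lborel"
      proof -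
        have "(\<lambda>x. x + c) = (+) c"
          by (simp add: fun_eq_iff add.commute)
        then show ?thesis
          using lborel_distr_plus[of c] by (simp only:)
      qed
      have "(AE x in lborel. x \<notin> A) \<longleftrightarrow> (AE x in distr lborel borel (\<lambda>x. x + c). x \<notin> A)"
        by (simp only: eq)
      also have "\<dots> \<longleftrightarrow> (AE x in lborel. x + c \<notin> A)"
        by (rule AE_distr_iff) measurable
      finally show ?thesis ..
    qed
    then show ?thesis by simp
  qed
  also have "\<dots> \<longleftrightarrow> (AE x in lborel. x \<notin> A)"
    by (rule eventually_const) (simp add: ae_filter_eq_bot_iff)
  finally show ?thesis .
qed

text \<open>Around each point of \<open>P\<close> there are arbitrarily small balls, of radius \<open>(1 + e) * norm h\<close>, that contain a
  hole of \<open>A\<close> of radius \<open>e * norm h\<close>. A Vitali subfamily of these balls inside \<open>U\<close> covers almost all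
  of \<open>P\<close>, and discarding the holes loses a fixed proportion of its volume.\<close>

lemma porous_cover_step:
  fixes A P U :: "'a::euclidean_space set"
  assumes A [measurable]: "A \<in> sets borel" and e: "0 < e"
    and porous: "\<And>x d. x \<in> P \<Longrightarrow> 0 < d \<Longrightarrow>
           \<exists>h. h \<noteq> 0 \<and> norm h < d \<and> ball (x + h) (e * norm h) \<inter> A = {}"
    and "P \<subseteq> A" "P \<subseteq> U" "open U" "U \<in> lmeasurable"
  obtains W where "P \<subseteq> W" "W \<in> lmeasurable"
    and "measure lebesgue W \<le> (1 - (e / (1 + e)) ^ DIM('a)) * measure lebesgue U"
proof -
  define \<theta> where "\<theta> = (e / (1 + e)) ^ DIM('a)"
  have \<theta>: "0 < \<theta>" "\<theta> \<le> 1"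
    using e by (auto simp: \<theta>_def intro!: power_le_one)
  define R where "R h = (1 + e) * norm h" for h :: 'a
  define Bl where "Bl i = ball (fst i) (R (snd i))" for i :: "'a \<times> 'a"
  define Ho where "Ho i = ball (fst i + snd i) (e * norm (snd i))" for i :: "'a \<times> 'a"
  define K where "K = {i. snd i \<noteq> 0 \<and> Bl i \<subseteq> U \<and> Ho i \<inter> A = {}}"
  have "\<exists>i. i \<in> K \<and> x \<in> ball (fst i) (R (snd i)) \<and> R (snd i) < d" if x: "x \<in> P" and d: "0 < d" for x d
  proof -
    obtain s where s: "s > 0" "ball x s \<subseteq> U"
      using \<open>open U\<close> \<open>P \<subseteq> U\<close> x open_contains_ball by blast
    then obtain h where h: "h \<noteq> 0" "norm h < min d s / (1 + e)" "ball (x + h) (e * norm h) \<inter> A = {}"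
      using porous[OF x, of "min d s / (1 + e)"] d e by auto
    then have "R h < min d s" "0 < R h"
      using e by (auto simp: R_def field_simps add_pos_pos)
    then show ?thesis
      using s h by (intro exI[of _ "(x, h)"]) (auto simp: K_def Bl_def Ho_def)
  qed
  then obtain C where C: "countable C" "C \<subseteq> K"
     "pairwise (\<lambda>i j. disjnt (ball (fst i) (R (snd i))) (ball (fst j) (R (snd j)))) C"
     "negligible (P - (\<Union>i\<in>C. ball (fst i) (R (snd i))))"
    by (rule Vitali_covering_theorem_balls)
  have [measurable, simp]: "Bl i \<in> sets borel" "Ho i \<in> sets borel" for i
    by (auto simp: Bl_def Ho_def)
  have disj: "disjoint_family_on Bl C" "disjoint_family_on (\<lambda>i. Bl i - Ho i) C"
    using C(3) by (fastforce simp: disjoint_family_on_def pairwise_def disjnt_def Bl_def)+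
  have sub: "Ho i \<subseteq> Bl i" for i
  proof
    fix y assume "y \<in> Ho i"
    then show "y \<in> Bl i"
      using dist_triangle[of "fst i" y "fst i + snd i"]
      by (simp add: Ho_def Bl_def R_def dist_norm algebra_simps)
  qed
  have Ho: "emeasure lborel (Ho i) = ennreal (\<theta> * measure lborel (Bl i))"
    and Bl: "emeasure lborel (Bl i) = ennreal (measure lborel (Bl i))" for i
    using e by (simp_all add: Ho_def Bl_def R_def \<theta>_def emeasure_ball content_ball power_mult_distrib power_divide)
  have diff: "emeasure lborel (Bl i - Ho i) = ennreal (1 - \<theta>) * emeasure lborel (Bl i)" for i
  proof -
    have "emeasure lborel (Bl i - Ho i) = emeasure lborel (Bl i) - emeasure lborel (Ho i)"
      by (rule emeasure_Diff) (simp_all add: Ho sub)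
    also have "\<dots> = ennreal (measure lborel (Bl i) - \<theta> * measure lborel (Bl i))"
      using \<theta> by (subst Ho, subst Bl) (simp add: ennreal_minus)
    also have "\<dots> = ennreal (1 - \<theta>) * emeasure lborel (Bl i)"
      using \<theta> by (subst Bl) (simp add: ennreal_mult[symmetric] algebra_simps)
    finally show ?thesis .
  qed
  define B where "B = (\<Union>i\<in>C. Bl i - Ho i)"
  have [measurable, simp]: "B \<in> sets borel"
    unfolding B_def by (rule sets.countable_UN'[OF C(1)]) auto
  have "emeasure lborel B = (\<integral>\<^sup>+i. emeasure lborel (Bl i - Ho i) \<partial>count_space C)"
    unfolding B_def by (rule emeasure_UN_countable) (use C(1) disj in auto)
  also have "\<dots> = ennreal (1 - \<theta>) * (\<integral>\<^sup>+i. emeasure lborel (Bl i) \<partial>count_space C)"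
    by (simp add: diff nn_integral_cmult)
  also have "(\<integral>\<^sup>+i. emeasure lborel (Bl i) \<partial>count_space C) = emeasure lborel (\<Union>i\<in>C. Bl i)"
    by (rule emeasure_UN_countable[symmetric]) (use C(1) disj in auto)
  also have "\<dots> \<le> emeasure lborel U"
    using C(2) \<open>open U\<close> by (intro emeasure_mono) (auto simp: K_def)
  also have "\<dots> = ennreal (measure lebesgue U)"
    using emeasure_eq_measure2[OF \<open>U \<in> lmeasurable\<close>] \<open>open U\<close> by simp
  finally have "emeasure lborel B \<le> ennreal ((1 - \<theta>) * measure lebesgue U)"
    using \<theta> by (simp add: ennreal_mult mult_left_mono)
  then have B: "emeasure lebesgue B \<le> ennreal ((1 - \<theta>) * measure lebesgue U)"
    by simp
  then have B_lm: "B \<in> lmeasurable"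
    by (auto simp: fmeasurable_def intro: le_less_trans)
  define N where "N = P - (\<Union>i\<in>C. Bl i)"
  have N: "negligible N"
    using C(4) by (simp add: N_def Bl_def)
  show ?thesis
  proof (rule that[of "B \<union> N"])
    show "P \<subseteq> B \<union> N"
      using C(2) \<open>P \<subseteq> A\<close> unfolding B_def N_def K_def by blast
    show "B \<union> N \<in> lmeasurable"
      using B_lm N by (simp add: fmeasurable.Un negligible_imp_measurable)
    have "measure lebesgue (B \<union> N) = measure lebesgue B"
      using N B_lm by (simp add: measure_Un_null_set negligible_iff_null_sets fmeasurableD)
    also have "\<dots> \<le> (1 - \<theta>) * measure lebesgue U"
      using B \<theta> by (simp add: measure_def enn2real_leI)
    finally show "measure lebesgue (B \<union> N) \<le> (1 - (e / (1 + e)) ^ DIM('a)) * measure lebesgue U"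
      by (simp add: \<theta>_def)
  qed
qed

text \<open>Locally, the infimum \<open>m\<close> of the volumes of open sets around \<open>P\<close> is finite; the covering step followed by outer
  regularity improves any competitor by a fixed factor, so \<open>m = 0\<close>.\<close>

lemma negligible_porous:
  fixes A P :: "'a::euclidean_space set"
  assumes A [measurable]: "A \<in> sets borel" and e: "0 < e"
    and porous: "\<And>x d. x \<in> P \<Longrightarrow> 0 < d \<Longrightarrow>
           \<exists>h. h \<noteq> 0 \<and> norm h < d \<and> ball (x + h) (e * norm h) \<inter> A = {}"
    and "P \<subseteq> A"
  shows "negligible P"
proof -
  define \<theta> where "\<theta> = (e / (1 + e)) ^ DIM('a)"
  have \<theta>: "0 < \<theta>" "\<theta> \<le> 1"
    using e by (auto simp: \<theta>_def intro!: power_le_one)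
  have "negligible (P \<inter> ball 0 (real n))" for n
  proof -
    define Q where "Q = P \<inter> ball 0 (real n)"
    define V where "V = {measure lebesgue U |U. open U \<and> U \<in> lmeasurable \<and> Q \<subseteq> U}"
    define m where "m = Inf V"
    have ne: "V \<noteq> {}"
      unfolding V_def Q_def by (auto intro!: exI[of _ "ball 0 (real n)"])
    have bdd: "bdd_below V"
      by (rule bdd_belowI[of _ 0]) (auto simp: V_def)
    have m0: "m \<ge> 0"
      unfolding m_def using ne by (intro cInf_greatest) (auto simp: V_def)
    have "m \<le> 0"
    proof (rule ccontr)
      assume "\<not> m \<le> 0"
      then have m: "m > 0" by simp
      \<comment> \<open>The covering step gains the factor \<open>1 - \<theta>\<close>; enlarging \<open>W\<close> to an open set gives back half of the gain.\<close>
      then have "m < m / (1 - \<theta> / 2)"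
        using \<theta> by (simp add: field_simps)
      then obtain U where U: "open U" "U \<in> lmeasurable" "Q \<subseteq> U" "measure lebesgue U < m / (1 - \<theta> / 2)"
        using cInf_lessD[OF ne] unfolding m_def V_def by blast
      have mU: "measure lebesgue U > 0"
        using m cInf_lower[OF _ bdd, of "measure lebesgue U"] U unfolding m_def V_def by force
      obtain W where W: "Q \<subseteq> W" "W \<in> lmeasurable" "measure lebesgue W \<le> (1 - \<theta>) * measure lebesgue U"
        using porous_cover_step[OF A e, of Q U] porous \<open>P \<subseteq> A\<close> U unfolding \<theta>_def Q_def by blast
      obtain T where T: "open T" "W \<subseteq> T" "(T - W) \<in> lmeasurable"
          "emeasure lebesgue (T - W) < ennreal (\<theta> / 2 * measure lebesgue U)"
        using sets_lebesgue_outer_open[of W "\<theta> / 2 * measure lebesgue U"] W(2) mU \<theta> by auto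
      have TW: "T = W \<union> (T - W)"
        using T(2) by auto
      have T_lm: "T \<in> lmeasurable"
        using fmeasurable.Un[OF W(2) T(3)] TW by simp
      have "measure lebesgue T \<le> measure lebesgue W + measure lebesgue (T - W)"
        using measure_Un_le[of W lebesgue "T - W"] W(2) T(3) TW by (simp add: fmeasurableD)
      moreover have "measure lebesgue (T - W) < \<theta> / 2 * measure lebesgue U"
        using T(3,4) by (simp add: emeasure_eq_measure2 ennreal_less_iff)
      moreover have "m \<le> measure lebesgue T"
        unfolding m_def using T_lm T(1,2) W(1)
        by (intro cInf_lower bdd) (force simp: V_def simp del: measure_completion)
      moreover have "(1 - \<theta> / 2) * measure lebesgue U < m"
        using U(4) \<theta> by (simp add: field_simps)
      ultimately have "m < m"
        using W(3) by (simp add: algebra_simps)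
      then show False by simp
    qed
    then have "m = 0" using m0 by simp
    have "negligible Q"
      unfolding negligible_outer_le
    proof (intro allI impI)
      fix c :: real assume "c > 0"
      then obtain r where "r \<in> V" "r < c"
        using cInf_lessD[OF ne, of c] \<open>m = 0\<close> by (auto simp: m_def)
      then show "\<exists>T. Q \<subseteq> T \<and> T \<in> lmeasurable \<and> measure lebesgue T \<le> c"
        unfolding V_def using less_imp_le by blast
    qed
    then show ?thesis by (simp add: Q_def)
  qed
  then have "negligible (\<Union>n. P \<inter> ball 0 (real n))"
    by (intro negligible_countable_Union) auto
  moreover have "(\<Union>n. P \<inter> ball 0 (real n)) = P"
    using reals_Archimedean2 by auto
  ultimately show ?thesis by simp
qed

text \<open>A substitute for the Lebesgue density theorem: near almost every point of \<open>A\<close>, points at distance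
  \<open>norm h\<close> have neighbours in \<open>A\<close> at distance only \<open>e * norm h\<close>.\<close>

lemma AE_nonporous_point:
  fixes A :: "'a::euclidean_space set"
  assumes "A \<in> sets borel" and e: "0 < e"
  shows "AE x in lborel. x \<in> A \<longrightarrow> (\<exists>d>0. \<forall>h. norm h < d \<longrightarrow> (\<exists>y\<in>A. norm (x + h - y) \<le> e * norm h))"
proof -
  define P where "P = {x\<in>A. \<forall>d>0. \<exists>h. h \<noteq> 0 \<and> norm h < d \<and> ball (x + h) (e * norm h) \<inter> A = {}}"
  have "negligible P"
    by (rule negligible_porous[OF assms]) (auto simp: P_def)
  from AE_negligible[OF this] show ?thesis
  proof eventually_elim
    case (elim x)
    show ?case
    proof
      assume "x \<in> A"
      with elim obtain d where d: "d > 0" "\<And>h. h \<noteq> 0 \<Longrightarrow> norm h < d \<Longrightarrow> ball (x + h) (e * norm h) \<inter> A \<noteq> {}"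
        by (auto simp: P_def)
      have "\<exists>y\<in>A. norm (x + h - y) \<le> e * norm h" if "norm h < d" for h
      proof (cases "h = 0")
        case True
        then show ?thesis using \<open>x \<in> A\<close> by (intro bexI[of _ x]) auto
      next
        case False
        then show ?thesis using d(2)[OF False that] by (fastforce simp: dist_norm)
      qed
      with d(1) show "\<exists>d>0. \<forall>h. norm h < d \<longrightarrow> (\<exists>y\<in>A. norm (x + h - y) \<le> e * norm h)"
        by blast
    qed
  qed
qed

section \<open>Rademacher's theorem\<close>

lemma lipschitz_on_line:
  fixes f :: "'a::real_normed_vector \<Rightarrow> 'b::metric_space"
  assumes lip: "L-lipschitz_on UNIV f"
  shows "(L * norm v)-lipschitz_on UNIV (\<lambda>t. f (x + t *\<^sub>R v))"
proof (rule lipschitz_onI)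
  fix s t :: real
  have "dist (f (x + s *\<^sub>R v)) (f (x + t *\<^sub>R v)) \<le> L * dist (x + s *\<^sub>R v) (x + t *\<^sub>R v)"
    using lip by (rule lipschitz_onD) auto
  then show "dist (f (x + s *\<^sub>R v)) (f (x + t *\<^sub>R v)) \<le> L * norm v * dist s t"
    by (simp add: dist_norm mult_ac flip: scaleR_diff_left)
qed (use lipschitz_on_nonneg[OF lip] in auto)

text \<open>Points at which the slope of \<open>f\<close> in direction \<open>v\<close> is \<open>q\<close> up to \<open>\<epsilon>\<close>, at all scales up to \<open>1 / (m + 1)\<close>. For
  continuous \<open>f\<close> these sets are closed, so that no measurability of derivatives has to be established
  beforehand, and countably many of them suffice.\<close>

definition slope_set :: "('a::euclidean_space \<Rightarrow> real) \<Rightarrow> 'a \<Rightarrow> real \<Rightarrow> nat \<Rightarrow> real \<Rightarrow> 'a set" where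
  "slope_set f v \<epsilon> m q =
     (\<Inter>t\<in>{t. \<bar>t\<bar> \<le> inverse (Suc m)}. {x. \<bar>f (x + t *\<^sub>R v) - f x - t * q\<bar> \<le> \<epsilon> * \<bar>t\<bar>})"

lemma closed_slope_set:
  assumes "continuous_on UNIV f"
  shows "closed (slope_set f v \<epsilon> m q)"
  unfolding slope_set_def using assms
  by (intro closed_INT ballI closed_Collect_le continuous_intros continuous_on_compose2[OF assms]) auto

text \<open>On every line parallel to \<open>v\<close> the one-dimensional theorem gives the claim almost everywhere;
  \<open>AE_on_lines_iff\<close> transfers this to the whole space.\<close>

lemma AE_in_slope_set:
  fixes f :: "'a::euclidean_space \<Rightarrow> real"
  assumes lip: "L-lipschitz_on UNIV f" and "\<epsilon> > 0"
  shows "AE x in lborel. \<exists>m. \<exists>q\<in>\<rat>. x \<in> slope_set f v \<epsilon> m q"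
proof -
  define B where "B = - (\<Union>m. \<Union>q\<in>\<rat>. slope_set f v \<epsilon> m q)"
  have [measurable]: "slope_set f v \<epsilon> m q \<in> sets borel" for m q
    using closed_slope_set lipschitz_on_continuous_on[OF lip] borel_closed by blast
  have B: "B \<in> sets borel"
  proof -
    have "(\<Union>q\<in>\<rat>. slope_set f v \<epsilon> m q) \<in> sets borel" for m
      by (rule sets.countable_UN'[OF countable_rat]) auto
    then show ?thesis
      unfolding B_def by (intro borel_comp sets.countable_UN) auto
  qed
  have "AE t in lborel. x + t *\<^sub>R v \<notin> B" for x
  proof -
    obtain g N where N: "negligible N"
      and g: "\<And>t. t \<notin> N \<Longrightarrow> ((\<lambda>t. f (x + t *\<^sub>R v)) has_real_derivative g t) (at t)"
      by (rule lipschitz_real_differentiable_ae[OF lipschitz_on_line[OF lip]]) blast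
    from AE_negligible[OF N] show ?thesis
    proof eventually_elim
      case (elim t)
      obtain q where q: "q \<in> \<rat>" "g t - \<epsilon> / 2 < q" "q < g t + \<epsilon> / 2"
        using Rats_dense_in_real[of "g t - \<epsilon> / 2" "g t + \<epsilon> / 2"] \<open>\<epsilon> > 0\<close> by auto
      obtain d where d: "d > 0"
        "\<And>h. h \<noteq> 0 \<Longrightarrow> \<bar>h\<bar> < d \<Longrightarrow> \<bar>(f (x + (t + h) *\<^sub>R v) - f (x + t *\<^sub>R v)) / h - g t\<bar> < \<epsilon> / 2"
        using g[OF elim] \<open>\<epsilon> > 0\<close> unfolding DERIV_def LIM_eq by (metis diff_zero half_gt_zero real_norm_def)
      obtain m where m: "inverse (real (Suc m)) < d"
        using reals_Archimedean[OF d(1)] by auto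
      have "x + t *\<^sub>R v \<in> slope_set f v \<epsilon> m q"
        unfolding slope_set_def
      proof (intro INT_I CollectI)
        fix h assume "h \<in> {h. \<bar>h\<bar> \<le> inverse (real (Suc m))}"
        then have h: "\<bar>h\<bar> < d" using m by auto
        show "\<bar>f (x + t *\<^sub>R v + h *\<^sub>R v) - f (x + t *\<^sub>R v) - h * q\<bar> \<le> \<epsilon> * \<bar>h\<bar>"
        proof (cases "h = 0")
          case False
          define c where "c = (f (x + (t + h) *\<^sub>R v) - f (x + t *\<^sub>R v)) / h"
          have "\<bar>c - q\<bar> \<le> \<epsilon>"
            using d(2)[OF False h] q unfolding c_def by linarith
          then have "\<bar>h\<bar> * \<bar>c - q\<bar> \<le> \<bar>h\<bar> * \<epsilon>"
            by (rule mult_left_mono) auto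
          moreover have "h * c = f (x + (t + h) *\<^sub>R v) - f (x + t *\<^sub>R v)"
            using False by (simp add: c_def)
          then have "h * (c - q) = f (x + t *\<^sub>R v + h *\<^sub>R v) - f (x + t *\<^sub>R v) - h * q"
            by (simp add: right_diff_distrib scaleR_add_left add.assoc)
          ultimately show ?thesis
            by (metis abs_mult mult.commute)
        qed simp
      qed
      then show ?case
        using q(1) by (auto simp: B_def)
    qed
  qed
  then have "AE x in lborel. x \<notin> B"
    using AE_on_lines_iff[OF B, of v] by simp
  then show ?thesis
    by eventually_elim (auto simp: B_def)
qed

text \<open>The point of this form is that one slope \<open>q\<close> serves not only \<open>x\<close> but also the nearby base points
  \<open>x + p\<close>: a neighbour of \<open>x + p\<close> in the slope set of \<open>x\<close> has approximate slope \<open>q\<close>, and the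
  Lipschitz bound transports this estimate to \<open>x + p\<close>.\<close>

lemma AE_slope_stable_nearby:
  fixes f :: "'a::euclidean_space \<Rightarrow> real"
  assumes lip: "L-lipschitz_on UNIV f" and \<epsilon>: "\<epsilon> > 0"
  shows "AE x in lborel. \<exists>q. \<exists>d>0. \<forall>p t. norm p < d \<longrightarrow> \<bar>t\<bar> < d \<longrightarrow>
           \<bar>f (x + p + t *\<^sub>R v) - f (x + p) - t * q\<bar> \<le> \<epsilon> * (\<bar>t\<bar> + norm p)"
proof -
  have L: "L \<ge> 0" using lip by (rule lipschitz_on_nonneg)
  \<comment> \<open>Moving both end points by \<open>e * norm p\<close> costs \<open>2 * L * e * norm p\<close>; the summand \<open>1\<close> covers \<open>L = 0\<close>.\<close>
  define e where "e = \<epsilon> / (2 * L + 1)"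
  have e: "e > 0" "2 * L * e \<le> \<epsilon>"
    using \<epsilon> L by (auto simp: e_def field_simps)
  have "AE x in lborel. \<forall>m. \<forall>q\<in>\<rat>. x \<in> slope_set f v \<epsilon> m q \<longrightarrow>
     (\<exists>d>0. \<forall>h. norm h < d \<longrightarrow> (\<exists>y\<in>slope_set f v \<epsilon> m q. norm (x + h - y) \<le> e * norm h))"
    unfolding AE_all_countable AE_ball_countable[OF countable_rat]
    using closed_slope_set[OF lipschitz_on_continuous_on[OF lip]] e
    by (intro allI ballI AE_nonporous_point borel_closed) auto
  with AE_in_slope_set[OF lip \<epsilon>, of v] show ?thesis
  proof eventually_elim
    case (elim x)
    then obtain m q d where d: "d > 0"
      and y: "\<And>h. norm h < d \<Longrightarrow> \<exists>y\<in>slope_set f v \<epsilon> m q. norm (x + h - y) \<le> e * norm h"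
      by blast
    define d' where "d' = min d (inverse (Suc m))"
    have "\<bar>f (x + p + t *\<^sub>R v) - f (x + p) - t * q\<bar> \<le> \<epsilon> * (\<bar>t\<bar> + norm p)"
      if p: "norm p < d'" and t: "\<bar>t\<bar> < d'" for p t
    proof -
      obtain y where y: "y \<in> slope_set f v \<epsilon> m q" "norm (x + p - y) \<le> e * norm p"
        using y[of p] p by (auto simp: d'_def)
      have 1: "\<bar>f (y + t *\<^sub>R v) - f y - t * q\<bar> \<le> \<epsilon> * \<bar>t\<bar>"
        using y(1) t by (auto simp: slope_set_def d'_def)
      have "\<bar>f (x + p + t *\<^sub>R v) - f (y + t *\<^sub>R v)\<bar> \<le> L * norm (x + p - y)"
        using lipschitz_onD[OF lip, of "x + p + t *\<^sub>R v" "y + t *\<^sub>R v"] by (simp add: dist_norm)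
      moreover have "\<bar>f (x + p) - f y\<bar> \<le> L * norm (x + p - y)"
        using lipschitz_onD[OF lip, of "x + p" y] by (simp add: dist_norm)
      moreover have "L * norm (x + p - y) \<le> L * (e * norm p)"
        using y(2) L by (rule mult_left_mono)
      moreover have "2 * L * e * norm p \<le> \<epsilon> * norm p"
        using e(2) by (rule mult_right_mono) auto
      ultimately show ?thesis
        using 1 by (simp add: algebra_simps)
    qed
    moreover have "d' > 0" using d by (simp add: d'_def)
    ultimately show ?case by blast
  qed
qed

text \<open>The increment from \<open>x\<close> to \<open>x + h\<close> is telescoped along the coordinate directions. The intermediate
  base points differ from \<open>x\<close>, which is why slopes stable under a change of base point are required.\<close>

lemma approx_linear_of_stable_slopes:
  fixes f :: "'a::euclidean_space \<Rightarrow> real" and \<epsilon> :: real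
  assumes \<epsilon>: "\<epsilon> > 0"
    and stable: "\<And>b. b \<in> Basis \<Longrightarrow> \<exists>d>0. \<forall>p t. norm p < d \<longrightarrow> \<bar>t\<bar> < d \<longrightarrow>
           \<bar>f (x + p + t *\<^sub>R b) - f (x + p) - t * q b\<bar> \<le> \<epsilon> * (\<bar>t\<bar> + norm p)"
  shows "\<exists>d>0. \<forall>h. norm h < d \<longrightarrow>
           \<bar>f (x + h) - f x - h \<bullet> (\<Sum>b\<in>Basis. q b *\<^sub>R b)\<bar> \<le> 2 * DIM('a) * \<epsilon> * norm h"
proof -
  define p where "p F h = (\<Sum>b\<in>F. (h \<bullet> b) *\<^sub>R b)" for F and h :: 'a
  have p: "norm (p F h) \<le> norm h" if "F \<subseteq> Basis" for F h
  proof (rule norm_le_componentwise)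
    fix b :: 'a assume "b \<in> Basis"
    moreover have "finite F" using that finite_Basis finite_subset by blast
    ultimately show "\<bar>p F h \<bullet> b\<bar> \<le> \<bar>h \<bullet> b\<bar>"
      using that by (auto simp: p_def inner_sum_left inner_Basis subset_iff if_distrib sum.delta cong: if_cong sum.cong
           intro: order_trans[OF eq_refl])
  qed
  have "\<exists>d>0. \<forall>h. norm h < d \<longrightarrow>
      \<bar>f (x + p F h) - f x - (\<Sum>b\<in>F. (h \<bullet> b) * q b)\<bar> \<le> 2 * card F * \<epsilon> * norm h"
    if "finite F" "F \<subseteq> Basis" for F
    using that
  proof induction
    case empty
    then show ?case by (auto simp: p_def intro!: exI[of _ 1])
  next
    case (insert b F)
    then obtain d1 where d1: "d1 > 0" "\<And>h. norm h < d1 \<Longrightarrow>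
      \<bar>f (x + p F h) - f x - (\<Sum>b\<in>F. (h \<bullet> b) * q b)\<bar> \<le> 2 * card F * \<epsilon> * norm h" by auto
    obtain d2 where d2: "d2 > 0" "\<And>p t. norm p < d2 \<Longrightarrow> \<bar>t\<bar> < d2 \<Longrightarrow>
           \<bar>f (x + p + t *\<^sub>R b) - f (x + p) - t * q b\<bar> \<le> \<epsilon> * (\<bar>t\<bar> + norm p)"
      using stable[of b] insert by auto
    have "\<bar>f (x + p (insert b F) h) - f x - (\<Sum>b\<in>insert b F. (h \<bullet> b) * q b)\<bar>
       \<le> 2 * card (insert b F) * \<epsilon> * norm h" if h: "norm h < min d1 d2" for h
    proof -
      have hb: "\<bar>h \<bullet> b\<bar> \<le> norm h"
        using insert by (auto intro: Basis_le_norm)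
      have pF: "norm (p F h) \<le> norm h"
        using insert p by auto
      have "\<bar>f (x + p F h + (h \<bullet> b) *\<^sub>R b) - f (x + p F h) - (h \<bullet> b) * q b\<bar>
          \<le> \<epsilon> * (\<bar>h \<bullet> b\<bar> + norm (p F h))"
        using hb pF h by (intro d2(2)) auto
      also have "\<dots> \<le> \<epsilon> * (norm h + norm h)"
        using hb pF \<epsilon> by (intro mult_left_mono) auto
      finally have "\<bar>f (x + p F h + (h \<bullet> b) *\<^sub>R b) - f (x + p F h) - (h \<bullet> b) * q b\<bar> \<le> 2 * \<epsilon> * norm h"
        by simp
      moreover have "x + p (insert b F) h = x + p F h + (h \<bullet> b) *\<^sub>R b"
        using insert by (simp add: p_def add_ac)
      moreover have "\<bar>f (x + p F h) - f x - (\<Sum>b\<in>F. (h \<bullet> b) * q b)\<bar> \<le> 2 * card F * \<epsilon> * norm h"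
        using h by (intro d1) auto
      ultimately show ?thesis
        using insert by (simp add: algebra_simps)
    qed
    then show ?case
      using d1(1) d2(1) by (intro exI[of _ "min d1 d2"]) auto
  qed
  from this[OF finite_Basis order_refl] show ?thesis
    by (simp add: p_def euclidean_representation inner_sum_right mult.commute)
qed

text \<open>Approximate gradients for the accuracies \<open>1 / (k + 1)\<close> form a Cauchy sequence: testing two of
  them with an increment parallel to their difference bounds that difference.\<close>

lemma GDERIV_of_approx_linear:
  fixes f :: "'a::euclidean_space \<Rightarrow> real"
  assumes "\<And>k::nat. \<exists>a. \<exists>d>0. \<forall>h. norm h < d \<longrightarrow> \<bar>f (x + h) - f x - h \<bullet> a\<bar> \<le> inverse (Suc k) * norm h"
  shows "\<exists>D. GDERIV f x :> D"
proof -
  obtain a d where d: "\<And>k. d k > 0"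
    and a: "\<And>k h. norm h < d k \<Longrightarrow> \<bar>f (x + h) - f x - h \<bullet> a k\<bar> \<le> inverse (Suc k) * norm h"
    using assms by metis
  have diff: "norm (a j - a k) \<le> inverse (Suc j) + inverse (Suc k)" for j k
  proof (cases "a j = a k")
    case False
    define c where "c = min (d j) (d k) / (2 * norm (a j - a k))"
    define h where "h = c *\<^sub>R (a j - a k)"
    have c: "c > 0" using False d by (simp add: c_def)
    have nh: "norm h = min (d j) (d k) / 2"
      using False d[of j] d[of k] by (simp add: h_def c_def)
    have "h \<bullet> (a j - a k) = norm h * norm (a j - a k)"
      using c by (simp add: h_def dot_square_norm power2_eq_square)
    moreover have "h \<bullet> (a j - a k) \<le> (inverse (Suc j) + inverse (Suc k)) * norm h"
    proof -
      have "norm h < d j" "norm h < d k"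
        using nh d[of j] d[of k] by auto
      from a[OF this(1)] a[OF this(2)] show ?thesis
        by (simp add: inner_diff_right distrib_right)
    qed
    ultimately have "norm h * norm (a j - a k) \<le> norm h * (inverse (Suc j) + inverse (Suc k))"
      by (simp add: mult.commute)
    moreover have "norm h > 0" unfolding nh using d[of j] d[of k] by simp
    ultimately show ?thesis by (rule mult_left_le_imp_le)
  qed simp
  have inv0: "(\<lambda>j. inverse (real (Suc j))) \<longlonglongrightarrow> 0"
    by (rule LIMSEQ_inverse_real_of_nat)
  have "Cauchy a"
  proof (rule CauchyI)
    fix e :: real assume "e > 0"
    then obtain M where M: "inverse (real (Suc M)) < e / 2"
      using reals_Archimedean[of "e / 2"] by auto
    have "norm (a m - a n) < e" if "m \<ge> M" "n \<ge> M" for m n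
    proof -
      have "inverse (real (Suc m)) \<le> inverse (real (Suc M))" "inverse (real (Suc n)) \<le> inverse (real (Suc M))"
        using that by (auto intro!: le_imp_inverse_le)
      then show ?thesis using diff[of m n] M by linarith
    qed
    then show "\<exists>M. \<forall>m\<ge>M. \<forall>n\<ge>M. norm (a m - a n) < e" by blast
  qed
  then obtain D where D: "a \<longlonglongrightarrow> D"
    using Cauchy_convergent convergent_def by blast
  have aD: "norm (a k - D) \<le> inverse (Suc k)" for k
  proof (rule LIMSEQ_le)
    show "(\<lambda>j. norm (a k - a j)) \<longlonglongrightarrow> norm (a k - D)"
      by (intro tendsto_intros D)
    show "(\<lambda>j. inverse (real (Suc k)) + inverse (real (Suc j))) \<longlonglongrightarrow> inverse (real (Suc k))"
      using tendsto_add[OF tendsto_const inv0] by simp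
  qed (use diff in auto)
  have "(f has_derivative (\<lambda>h. h \<bullet> D)) (at x)"
    unfolding has_derivative_at_alt
  proof (intro conjI allI impI)
    fix e :: real assume "e > 0"
    then obtain k where k: "inverse (real (Suc k)) < e / 2"
      using reals_Archimedean[of "e / 2"] by auto
    have "\<bar>f y - f x - (y - x) \<bullet> D\<bar> \<le> e * norm (y - x)" if "norm (y - x) < d k" for y
    proof -
      have "\<bar>f y - f x - (y - x) \<bullet> a k\<bar> \<le> inverse (Suc k) * norm (y - x)"
        using a[of "y - x" k] that by simp
      moreover have "\<bar>(y - x) \<bullet> (a k - D)\<bar> \<le> norm (y - x) * inverse (Suc k)"
        using Cauchy_Schwarz_ineq2[of "y - x" "a k - D"] mult_left_mono[OF aD[of k], of "norm (y - x)"] by simp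
      moreover have "2 * inverse (Suc k) * norm (y - x) \<le> e * norm (y - x)"
        using k by (intro mult_right_mono) auto
      ultimately show ?thesis
        by (simp add: inner_diff_right algebra_simps)
    qed
    then show "\<exists>d>0. \<forall>y. norm (y - x) < d \<longrightarrow> norm (f y - f x - (y - x) \<bullet> D) \<le> e * norm (y - x)"
      using d[of k] by auto
  qed (rule bounded_linear_inner_left)
  then show ?thesis
    unfolding gderiv_def by blast
qed

theorem rademacher:
  fixes f :: "'a::euclidean_space \<Rightarrow> real"
  assumes lip: "L-lipschitz_on UNIV f"
  shows "AE x in lborel. \<exists>D. GDERIV f x :> D"
proof -
  \<comment> \<open>Telescoping over the coordinates multiplies the error by twice the dimension.\<close>
  define \<epsilon> where "\<epsilon> k = inverse (real (Suc k)) / (2 * DIM('a))" for k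
  have \<epsilon>: "\<epsilon> k > 0" for k by (simp add: \<epsilon>_def)
  have "AE x in lborel. \<forall>k. \<forall>b\<in>Basis. \<exists>q. \<exists>d>0. \<forall>p t. norm p < d \<longrightarrow> \<bar>t\<bar> < d \<longrightarrow>
           \<bar>f (x + p + t *\<^sub>R b) - f (x + p) - t * q\<bar> \<le> \<epsilon> k * (\<bar>t\<bar> + norm p)"
    unfolding AE_all_countable AE_ball_countable[OF countable_finite[OF finite_Basis]]
    using AE_slope_stable_nearby[OF lip \<epsilon>] by blast
  then show ?thesis
  proof eventually_elim
    case (elim x)
    show ?case
    proof (rule GDERIV_of_approx_linear)
      fix k
      obtain q where "\<And>b. b \<in> Basis \<Longrightarrow> \<exists>d>0. \<forall>p t. norm p < d \<longrightarrow> \<bar>t\<bar> < d \<longrightarrow>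
           \<bar>f (x + p + t *\<^sub>R b) - f (x + p) - t * q b\<bar> \<le> \<epsilon> k * (\<bar>t\<bar> + norm p)"
        using elim by metis
      from approx_linear_of_stable_slopes[OF \<epsilon> this]
      show "\<exists>a. \<exists>d>0. \<forall>h. norm h < d \<longrightarrow> \<bar>f (x + h) - f x - h \<bullet> a\<bar> \<le> inverse (Suc k) * norm h"
        by (auto simp: \<epsilon>_def)
    qed
  qed
qed

section \<open>Gradients of Lipschitz functions\<close>

lemma grad_eq: "GDERIV f x :> D \<Longrightarrow> grad f x = D"
proof -
  assume D: "GDERIV f x :> D"
  have "D' = D" if "GDERIV f x :> D'" for D'
    using has_derivative_unique[OF D[unfolded gderiv_def] that[unfolded gderiv_def]]
    by (metis vector_eq_rdot inner_commute)
  then have "(THE D. GDERIV f x :> D) = D"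
    using D by (intro the_equality)
  then show ?thesis
    unfolding grad_def using D by (simp only: if_P[OF exI])
qed

lemma GDERIV_along_line:
  assumes "GDERIV f (x + t *\<^sub>R v) :> D"
  shows "((\<lambda>t. f (x + t *\<^sub>R v)) has_real_derivative (D \<bullet> v)) (at t)"
proof -
  have "((\<lambda>t. x + t *\<^sub>R v) has_derivative (\<lambda>s. s *\<^sub>R v)) (at t)"
    by (auto intro!: derivative_eq_intros)
  from has_derivative_compose[OF this assms[unfolded gderiv_def]]
  show ?thesis
    by (simp add: has_field_derivative_def inner_commute mult_commute_abs)
qed

lemma grad_cong:
  assumes "open S" "x \<in> S" "\<And>y. y \<in> S \<Longrightarrow> f y = g y"
  shows "grad f x = grad g x"
proof -
  have "GDERIV f x :> D \<longleftrightarrow> GDERIV g x :> D" for D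
    unfolding gderiv_def using assms
    by (metis has_derivative_transform_within_open)
  then have "(\<lambda>D. GDERIV f x :> D) = (\<lambda>D. GDERIV g x :> D)" by blast
  then show ?thesis unfolding grad_def by (simp only:)
qed

lemma norm_grad_le_lipschitz:
  assumes "open S" "x \<in> S" and lip: "L-lipschitz_on S f"
  shows "norm (grad f x) \<le> L"
proof (cases "\<exists>D. GDERIV f x :> D")
  case True
  then obtain D where D: "GDERIV f x :> D" by blast
  have "((\<lambda>t. f (x + t *\<^sub>R D)) has_real_derivative (D \<bullet> D)) (at 0)"
    using GDERIV_along_line[of f x 0 D D] D by simp
  then have lim: "((\<lambda>h. (f (x + h *\<^sub>R D) - f x) / h) \<longlongrightarrow> D \<bullet> D) (at 0)"
    by (simp add: DERIV_def)
  have "((\<lambda>h. x + h *\<^sub>R D) \<longlongrightarrow> x + 0 *\<^sub>R D) (at (0::real))"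
    by (intro tendsto_intros)
  then have "\<forall>\<^sub>F h in at (0::real). x + h *\<^sub>R D \<in> S"
    using assms(1,2) topological_tendstoD by fastforce
  moreover have "\<forall>\<^sub>F h in at (0::real). h \<noteq> 0"
    by (simp add: eventually_at_filter)
  ultimately have "\<forall>\<^sub>F h in at 0. (f (x + h *\<^sub>R D) - f x) / h \<le> L * norm D"
  proof eventually_elim
    case (elim h)
    have "\<bar>f (x + h *\<^sub>R D) - f x\<bar> \<le> L * norm D * \<bar>h\<bar>"
      using lipschitz_onD[OF lip elim(1) assms(2)] by (simp add: dist_norm mult_ac)
    then have "\<bar>(f (x + h *\<^sub>R D) - f x) / h\<bar> \<le> L * norm D"
      using elim(2) by (simp add: pos_divide_le_eq)
    then show ?case by linarith
  qed
  then have "D \<bullet> D \<le> L * norm D"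
    by (intro tendsto_upperbound[OF lim]) auto
  then have "norm D * norm D \<le> L * norm D"
    by (simp add: dot_square_norm power2_eq_square)
  then have "norm D \<le> L"
    using lipschitz_on_nonneg[OF lip] by (cases "D = 0") (auto simp: mult_le_cancel_right)
  then show ?thesis
    by (simp add: grad_eq[OF D])
next
  case False
  then show ?thesis
    using lipschitz_on_nonneg[OF lip] by (simp add: grad_def)
qed

text \<open>Lebesgue measure is complete, so measurability is insensitive to modification on null sets.\<close>

lemma measurable_lebesgue_AE_cong:
  assumes G: "G \<in> borel \<rightarrow>\<^sub>M M" and eq: "AE x in lborel. f x = G x" and f: "\<And>x. f x \<in> space M"
  shows "f \<in> lebesgue \<rightarrow>\<^sub>M M"
proof (rule measurableI)
  fix A assume A: "A \<in> sets M"
  have null: "AE x in lborel. \<not> f x \<noteq> G x" "AE x in lborel. \<not> (f x \<noteq> G x \<and> f x \<in> A)"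
    using eq by auto
  have "{x. f x \<noteq> G x} \<in> sets lebesgue" "{x. f x \<noteq> G x \<and> f x \<in> A} \<in> sets lebesgue"
    using null[THEN sets_completion_AE] by (simp_all add: pred_def)
  moreover have "{x. G x \<in> A} \<in> sets lebesgue"
    using measurable_sets[OF measurable_completion[of G lborel M] A] G by (simp add: vimage_def)
  ultimately have "({x. G x \<in> A} - {x. f x \<noteq> G x}) \<union> {x. f x \<noteq> G x \<and> f x \<in> A} \<in> sets lebesgue"
    by (intro sets.Un sets.Diff)
  also have "({x. G x \<in> A} - {x. f x \<noteq> G x}) \<union> {x. f x \<noteq> G x \<and> f x \<in> A} = f -` A \<inter> space lebesgue"
    by auto
  finally show "f -` A \<inter> space lebesgue \<in> sets lebesgue" .
qed (rule f)

text \<open>By Rademacher's theorem the gradient is almost everywhere the limit of difference quotients.\<close>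

lemma borel_measurable_grad_lipschitz:
  assumes lip: "L-lipschitz_on UNIV f"
  shows "grad f \<in> borel_measurable lebesgue"
proof -
  define G where "G x = (\<Sum>b\<in>Basis. lim (\<lambda>k. (f (x + inverse (real (Suc k)) *\<^sub>R b) - f x) / inverse (real (Suc k))) *\<^sub>R b)" for x
  have [measurable]: "f \<in> borel_measurable borel"
    using lipschitz_on_continuous_on[OF lip] by (rule borel_measurable_continuous_onI)
  have "G \<in> borel_measurable borel"
    unfolding G_def by measurable
  moreover have "AE x in lborel. grad f x = G x"
    using rademacher[OF lip]
  proof eventually_elim
    case (elim x)
    then obtain D where D: "GDERIV f x :> D" by blast
    have "lim (\<lambda>k. (f (x + inverse (real (Suc k)) *\<^sub>R b) - f x) / inverse (real (Suc k))) = D \<bullet> b" for b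
    proof (rule limI)
      have "((\<lambda>t. f (x + t *\<^sub>R b)) has_real_derivative (D \<bullet> b)) (at 0)"
        using GDERIV_along_line[of f x 0 b D] D by simp
      then have "((\<lambda>h. (f (x + h *\<^sub>R b) - f x) / h) \<longlongrightarrow> D \<bullet> b) (at 0)"
        by (simp add: DERIV_def)
      moreover have "filterlim (\<lambda>k. inverse (real (Suc k))) (at 0) sequentially"
        using LIMSEQ_inverse_real_of_nat by (auto simp: filterlim_at)
      ultimately show "(\<lambda>k. (f (x + inverse (real (Suc k)) *\<^sub>R b) - f x) / inverse (real (Suc k))) \<longlonglongrightarrow> D \<bullet> b"
        by (rule filterlim_compose)
    qed
    then show ?case
      by (simp add: G_def grad_eq[OF D] euclidean_representation)
  qed
  ultimately show ?thesis
    by (intro measurable_lebesgue_AE_cong) auto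
qed

text \<open>The segment from \<open>x\<close> to \<open>y\<close> may lie inside the exceptional null set, but almost all of its translates
  meet that set in a one-dimensional null set. On these the increment is bounded by integrating the
  derivative, and continuity gives the bound for the segment itself.\<close>

lemma increment_le_of_AE_grad_bound:
  fixes f :: "'a::euclidean_space \<Rightarrow> real"
  assumes lip: "L-lipschitz_on UNIV f" and C: "C \<ge> 0" and S: "open S" "convex S"
    and bound: "AE x in lborel. x \<in> S \<longrightarrow> norm (grad f x) \<le> C"
    and x: "x \<in> S" and y: "y \<in> S"
  shows "\<bar>f y - f x\<bar> \<le> C * dist x y"
proof -
  define v where "v = y - x"
  have cont: "continuous_on UNIV f"
    using lip by (rule lipschitz_on_continuous_on)
  have "AE z in lborel. z \<in> S \<longrightarrow> (\<exists>D. GDERIV f z :> D \<and> norm D \<le> C)"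
    using rademacher[OF lip] bound by eventually_elim (auto simp: grad_eq)
  then obtain N where N: "N \<in> null_sets lborel" "\<And>z. z \<notin> N \<Longrightarrow> z \<in> S \<Longrightarrow> \<exists>D. GDERIV f z :> D \<and> norm D \<le> C"
    by (auto elim: AE_E3)
  then have "N \<in> sets borel" by auto
  from AE_on_lines_iff[OF this, of v]
  have lines: "AE z in lborel. AE t in lborel. z + t *\<^sub>R v \<notin> N"
    using N(1) AE_not_in by blast
  have good: "\<bar>f (z + v) - f z\<bar> \<le> C * norm v"
    if z: "AE t in lborel. z + t *\<^sub>R v \<notin> N" "z \<in> S" "z + v \<in> S" for z
  proof -
    have "AE t in lborel. 0 \<le> t \<and> t \<le> 1 \<longrightarrow>
        (\<exists>D. ((\<lambda>t. f (z + t *\<^sub>R v)) has_real_derivative D) (at t) \<and> \<bar>D\<bar> \<le> C * norm v)"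
      using z(1)
    proof eventually_elim
      case (elim t)
      show ?case
      proof
        assume t: "0 \<le> t \<and> t \<le> 1"
        have "z + t *\<^sub>R v = (1 - t) *\<^sub>R z + t *\<^sub>R (z + v)"
          by (simp add: algebra_simps)
        then have "z + t *\<^sub>R v \<in> S"
          using convexD_alt[OF S(2) z(2,3), of t] t by simp
        then obtain D where D: "GDERIV f (z + t *\<^sub>R v) :> D" "norm D \<le> C"
          using N(2)[OF elim] by blast
        from GDERIV_along_line[OF D(1)]
        have "((\<lambda>t. f (z + t *\<^sub>R v)) has_real_derivative (D \<bullet> v)) (at t)" .
        moreover have "\<bar>D \<bullet> v\<bar> \<le> C * norm v"
          using Cauchy_Schwarz_ineq2[of D v] mult_right_mono[OF D(2), of "norm v"] by simp
        ultimately show "\<exists>D. ((\<lambda>t. f (z + t *\<^sub>R v)) has_real_derivative D) (at t) \<and> \<bar>D\<bar> \<le> C * norm v"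
          by blast
      qed
    qed
    from lipschitz_real_increment_bound[OF lipschitz_on_line[OF lip] _ this] C show ?thesis
      by simp
  qed
  have "x \<in> closure {z. \<bar>f (z + v) - f z\<bar> \<le> C * norm v}"
    unfolding closure_approachable
  proof (intro allI impI)
    fix e :: real assume "e > 0"
    obtain d1 d2 where d: "d1 > 0" "ball x d1 \<subseteq> S" "d2 > 0" "ball y d2 \<subseteq> S"
      using S(1) x y open_contains_ball by meson
    define d where "d = min e (min d1 d2)"
    have d_pos: "d > 0"
      using \<open>e > 0\<close> d by (simp add: d_def)
    have "\<not> (AE z in lborel. z \<notin> ball x d)"
    proof
      assume "AE z in lborel. z \<notin> ball x d"
      then have "emeasure lborel (ball x d) = 0"
        using AE_iff_measurable[of "ball x d" lborel "\<lambda>z. z \<notin> ball x d"] by (simp add: ball_def)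
      then show False
        using d_pos unit_ball_vol_pos[of "real DIM('a)"] by (simp add: emeasure_ball)
    qed
    then obtain z where z: "z \<in> ball x d" "AE t in lborel. z + t *\<^sub>R v \<notin> N"
      using lines by (metis (mono_tags, lifting) eventually_mono)
    have "z + v \<in> ball y d2" "z \<in> ball x d1" "dist z x < e"
      using z(1) by (auto simp: d_def v_def dist_norm norm_minus_commute algebra_simps)
    then show "\<exists>z\<in>{z. \<bar>f (z + v) - f z\<bar> \<le> C * norm v}. dist z x < e"
      using good[OF z(2)] d by blast
  qed
  moreover have "closed {z. \<bar>f (z + v) - f z\<bar> \<le> C * norm v}"
    by (intro closed_Collect_le continuous_intros continuous_on_compose2[OF cont]) auto
  ultimately show ?thesis
    by (simp add: v_def dist_norm norm_minus_commute)
qed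

text \<open>McShane's extension: the lower envelope of the cones of slope \<open>L\<close> with vertices on the graph of \<open>f\<close>.\<close>

lemma lipschitz_on_extension:
  fixes f :: "'a::metric_space \<Rightarrow> real"
  assumes lip: "L-lipschitz_on S f"
  obtains h where "L-lipschitz_on UNIV h" "\<And>x. x \<in> S \<Longrightarrow> h x = f x"
proof (cases "S = {}")
  case True
  have "L-lipschitz_on UNIV (\<lambda>x::'a. 0::real)"
    using lipschitz_on_nonneg[OF lip] by (auto intro: lipschitz_onI)
  then show ?thesis using that True by auto
next
  case False
  then obtain c where c: "c \<in> S" by blast
  have L: "L \<ge> 0" using lip by (rule lipschitz_on_nonneg)
  have d: "\<bar>f x - f y\<bar> \<le> L * dist x y" if "x \<in> S" "y \<in> S" for x y
    using lipschitz_onD[OF lip that] by (simp add: dist_real_def)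
  define h where "h x = (INF y\<in>S. f y + L * dist x y)" for x
  have bdd: "bdd_below ((\<lambda>y. f y + L * dist x y) ` S)" for x
  proof (rule bdd_belowI2)
    fix y assume "y \<in> S"
    then have "f c - f y \<le> L * dist c y"
      using d[OF c, of y] by simp
    also have "\<dots> \<le> L * (dist x c + dist x y)"
      using L by (intro mult_left_mono) (metis dist_triangle3 dist_commute)
    finally show "f c - L * dist x c \<le> f y + L * dist x y"
      by (simp add: algebra_simps)
  qed
  have one: "h x \<le> h y + L * dist x y" for x y
  proof -
    have "h x - L * dist x y \<le> f z + L * dist y z" if "z \<in> S" for z
    proof -
      have "h x \<le> f z + L * dist x z"
        unfolding h_def using bdd that by (rule cINF_lower)
      also have "L * dist x z \<le> L * (dist x y + dist y z)"
        using L by (intro mult_left_mono dist_triangle)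
      finally show ?thesis by (simp add: algebra_simps)
    qed
    then have "h x - L * dist x y \<le> h y"
      unfolding h_def[of y] using False by (intro cINF_greatest) auto
    then show ?thesis by simp
  qed
  have "L-lipschitz_on UNIV h"
  proof (rule lipschitz_onI)
    fix x y
    show "dist (h x) (h y) \<le> L * dist x y"
      using one[of x y] one[of y x] by (simp add: dist_real_def dist_commute)
  qed (rule L)
  moreover have "h x = f x" if "x \<in> S" for x
  proof (rule antisym)
    show "h x \<le> f x"
      unfolding h_def using cINF_lower[OF bdd that, of x] by simp
    show "f x \<le> h x"
      unfolding h_def using False d[OF that]
      by (intro cINF_greatest) (auto simp: abs_le_iff algebra_simps)
  qed
  ultimately show ?thesis using that by blast
qed

section \<open>Lipschitz functions on a domain and the distance to its boundary\<close>

text \<open>The function \<open>grad\<close> is \<open>0\<close> at points of non-differentiability, and \<open>esssup\<close> is \<open>\<infinity>\<close>, hence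
  \<open>grad_norm\<close> is \<open>0\<close>, for a non-measurable argument. Measurability of the gradient is thus what
  makes \<open>grad_norm\<close> an actual bound.\<close>

lemma grad_norm_lipschitz:
  fixes u :: "'a::euclidean_space \<Rightarrow> real"
  assumes \<Omega>: "open \<Omega>" "\<Omega> \<noteq> {}" and lip: "L-lipschitz_on (closure \<Omega>) u"
  shows grad_norm_nonneg: "0 \<le> grad_norm \<Omega> u"
    and grad_norm_le: "grad_norm \<Omega> u \<le> L"
    and AE_grad_le_grad_norm: "AE x in lborel. x \<in> \<Omega> \<longrightarrow> norm (grad u x) \<le> grad_norm \<Omega> u"
proof -
  have [measurable]: "\<Omega> \<in> sets lebesgue"
    using \<Omega> by auto
  obtain h where h: "L-lipschitz_on UNIV h" "\<And>x. x \<in> closure \<Omega> \<Longrightarrow> h x = u x"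
    using lipschitz_on_extension[OF lip] by blast
  have gradh: "grad h x = grad u x" if "x \<in> \<Omega>" for x
    using h(2) closure_subset \<Omega>(1) that by (intro grad_cong[of \<Omega>]) auto
  have le: "norm (grad u x) \<le> L" if "x \<in> \<Omega>" for x
    using norm_grad_le_lipschitz[OF \<Omega>(1) that lipschitz_on_subset[OF lip closure_subset]] .
  define E where "E = esssup (lebesgue_on \<Omega>) (\<lambda>x. ereal (norm (grad u x)))"
  have "(\<lambda>x. ereal (norm (grad h x))) \<in> borel_measurable (lebesgue_on \<Omega>)"
    using borel_measurable_grad_lipschitz[OF h(1)] by (intro measurable_restrict_space1) measurable
  then have meas: "(\<lambda>x. ereal (norm (grad u x))) \<in> borel_measurable (lebesgue_on \<Omega>)"
    using gradh by (subst measurable_cong[of _ _ "\<lambda>x. ereal (norm (grad h x))"]) (auto simp: space_restrict_space)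
  have "E \<le> ereal L"
    unfolding E_def using le by (intro esssup_I[OF meas] AE_I2) (auto simp: space_restrict_space)
  have "AE x in lebesgue_on \<Omega>. ereal (norm (grad u x)) \<le> E"
    unfolding E_def by (rule esssup_AE)
  then have AE: "AE x in lborel. x \<in> \<Omega> \<longrightarrow> ereal (norm (grad u x)) \<le> E"
    by (simp add: AE_restrict_space_iff AE_completion_iff)
  have "\<not> (AE x in lborel. x \<notin> \<Omega>)"
  proof
    assume "AE x in lborel. x \<notin> \<Omega>"
    then have "emeasure lborel \<Omega> = 0"
      using AE_iff_measurable[of \<Omega> lborel "\<lambda>x. x \<notin> \<Omega>"] \<Omega> by simp
    then have "negligible \<Omega>"
      using \<Omega> by (simp add: negligible_iff_emeasure0)
    then show False
      using open_not_negligible[OF \<Omega>] by blast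
  qed
  then have "\<exists>x\<in>\<Omega>. ereal (norm (grad u x)) \<le> E"
    using AE by (metis (mono_tags, lifting) eventually_mono)
  then have "0 \<le> E"
    by (metis ereal_less_eq(5) norm_ge_zero order_trans)
  with \<open>E \<le> ereal L\<close> obtain e where e: "E = ereal e" "0 \<le> e" "e \<le> L"
    by (cases E) auto
  moreover have "grad_norm \<Omega> u = real_of_ereal E"
    by (simp add: grad_norm_def E_def)
  ultimately show "0 \<le> grad_norm \<Omega> u" "grad_norm \<Omega> u \<le> L"
     "AE x in lborel. x \<in> \<Omega> \<longrightarrow> norm (grad u x) \<le> grad_norm \<Omega> u"
    using AE by auto
qed

lemma infdist_frontier_pos:
  assumes "open \<Omega>" "x \<in> \<Omega>" "frontier \<Omega> \<noteq> {}"
  shows "0 < infdist x (frontier \<Omega>)"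
proof -
  have "x \<notin> frontier \<Omega>"
    using assms by (simp add: frontier_def interior_open)
  then show ?thesis
    using assms(3) by (simp add: infdist_pos_not_in_closed frontier_closed)
qed

lemma ball_infdist_frontier_subset:
  fixes x :: "'a::euclidean_space"
  assumes "x \<in> \<Omega>"
  shows "ball x (infdist x (frontier \<Omega>)) \<subseteq> \<Omega>"
proof (rule ccontr)
  let ?B = "ball x (infdist x (frontier \<Omega>))"
  assume "\<not> ?B \<subseteq> \<Omega>"
  then obtain w where "w \<in> ?B" "w \<notin> \<Omega>" by blast
  moreover from this have "x \<in> ?B"
    using zero_le_dist[of x w] by (simp del: zero_le_dist)
  ultimately have "?B - \<Omega> \<noteq> {}" "?B \<inter> \<Omega> \<noteq> {}"
    using assms by blast+
  then have "?B \<inter> frontier \<Omega> \<noteq> {}"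
    by (intro connected_Int_frontier) auto
  then obtain y where "y \<in> frontier \<Omega>" "dist x y < infdist x (frontier \<Omega>)" by auto
  then show False
    using infdist_le[of y "frontier \<Omega>" x] by simp
qed

text \<open>The ball around \<open>x\<close> that touches the boundary is convex and contained in \<open>\<Omega>\<close>, so that the bound on
  the gradient integrates along its radii; continuity covers end points on the boundary. Applied with
  a boundary point nearest to \<open>x\<close>, the estimate compares \<open>u x\<close> with a boundary value.\<close>

lemma increment_le_grad_norm:
  fixes u :: "'a::euclidean_space \<Rightarrow> real"
  assumes \<Omega>: "open \<Omega>" "frontier \<Omega> \<noteq> {}" and u: "u \<in> Lip \<Omega>" and x: "x \<in> \<Omega>"
    and y: "dist x y \<le> infdist x (frontier \<Omega>)"
  shows "\<bar>u y - u x\<bar> \<le> grad_norm \<Omega> u * dist x y"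
proof -
  have ne: "\<Omega> \<noteq> {}" using x by blast
  obtain L where L: "L-lipschitz_on (closure \<Omega>) u"
    using u by (auto simp: Lip_def)
  obtain h where h: "L-lipschitz_on UNIV h" "\<And>x. x \<in> closure \<Omega> \<Longrightarrow> h x = u x"
    using lipschitz_on_extension[OF L] by blast
  let ?B = "ball x (infdist x (frontier \<Omega>))"
  note pos = infdist_frontier_pos[OF \<Omega>(1) x \<Omega>(2)]
  note sub = ball_infdist_frontier_subset[OF x]
  have gradh: "grad h z = grad u z" if "z \<in> \<Omega>" for z
    using h(2) closure_subset \<Omega>(1) that by (intro grad_cong[of \<Omega>]) auto
  have "AE z in lborel. z \<in> ?B \<longrightarrow> norm (grad h z) \<le> grad_norm \<Omega> u"
    using AE_grad_le_grad_norm[OF \<Omega>(1) ne L] by eventually_elim (use sub gradh in auto)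
  then have "?B \<subseteq> {z. \<bar>h z - h x\<bar> \<le> grad_norm \<Omega> u * dist x z}"
    using increment_le_of_AE_grad_bound[OF h(1) grad_norm_nonneg[OF \<Omega>(1) ne L], of ?B x] pos by auto
  then have "closure ?B \<subseteq> {z. \<bar>h z - h x\<bar> \<le> grad_norm \<Omega> u * dist x z}"
    by (rule closure_minimal)
       (intro closed_Collect_le continuous_intros lipschitz_on_continuous_on[OF h(1)])
  moreover have "y \<in> closure ?B"
    using y pos by (simp add: closure_ball)
  moreover have "closure ?B \<subseteq> closure \<Omega>"
    using sub by (rule closure_mono)
  moreover have "x \<in> closure \<Omega>"
    using x closure_subset by blast
  ultimately have "\<bar>h y - h x\<bar> \<le> grad_norm \<Omega> u * dist x y" "h y = u y" "h x = u x"
    using h(2) by blast+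
  then show ?thesis by simp
qed

lemma set_integrable_Lip:
  fixes u :: "'a::euclidean_space \<Rightarrow> real"
  assumes \<Omega>: "bounded \<Omega>" and u: "u \<in> Lip \<Omega>" and \<mu>: "sets \<mu> = sets borel" "finite_measure \<mu>"
  shows "set_integrable \<mu> (closure \<Omega>) u"
proof -
  obtain L where L: "L-lipschitz_on (closure \<Omega>) u"
    using u by (auto simp: Lip_def)
  obtain h where h: "L-lipschitz_on UNIV h" "\<And>x. x \<in> closure \<Omega> \<Longrightarrow> h x = u x"
    using lipschitz_on_extension[OF L] by blast
  have cont: "continuous_on UNIV h"
    using h(1) by (rule lipschitz_on_continuous_on)
  then have "h \<in> borel_measurable borel"
    by (rule borel_measurable_continuous_onI)
  then have [measurable]: "h \<in> borel_measurable \<mu>"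
    using measurable_cong_sets[OF \<mu>(1) refl] by blast
  have [measurable]: "closure \<Omega> \<in> sets \<mu>"
    using \<mu>(1) by simp
  have "compact (h ` closure \<Omega>)"
    using \<Omega> cont by (intro compact_continuous_image) (auto intro: continuous_on_subset simp: compact_closure)
  then obtain B where B: "B > 0" "\<And>x. x \<in> closure \<Omega> \<Longrightarrow> \<bar>h x\<bar> \<le> B"
    using compact_imp_bounded[of "h ` closure \<Omega>"] by (auto simp: bounded_pos)
  have "integrable \<mu> (\<lambda>x. indicator (closure \<Omega>) x *\<^sub>R h x)"
    using B by (intro finite_measure.integrable_const_bound[OF \<mu>(2), of _ B]) (auto simp: indicator_def)
  also have "(\<lambda>x. indicator (closure \<Omega>) x *\<^sub>R h x) = (\<lambda>x. indicator (closure \<Omega>) x *\<^sub>R u x)"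
    using h(2) by (auto simp: indicator_def)
  finally show ?thesis
    by (simp add: set_integrable_def)
qed

lemma abs_le_sup_norm:
  fixes u :: "'a::euclidean_space \<Rightarrow> real"
  assumes \<Omega>: "bounded \<Omega>" and u: "u \<in> Lip \<Omega>" and x: "x \<in> closure \<Omega>"
  shows "\<bar>u x\<bar> \<le> sup_norm \<Omega> u"
proof -
  obtain L where "L-lipschitz_on (closure \<Omega>) u"
    using u by (auto simp: Lip_def)
  then have "continuous_on (closure \<Omega>) (\<lambda>x. \<bar>u x\<bar>)"
    by (intro continuous_intros lipschitz_on_continuous_on)
  then have "compact ((\<lambda>x. \<bar>u x\<bar>) ` closure \<Omega>)"
    using \<Omega> by (intro compact_continuous_image) (auto simp: compact_closure)
  then have "bdd_above ((\<lambda>x. \<bar>u x\<bar>) ` closure \<Omega>)"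
    by (intro bounded_imp_bdd_above compact_imp_bounded)
  then show ?thesis
    unfolding sup_norm_def using x by (intro cSUP_upper)
qed

lemma infdist_lipschitz: "1-lipschitz_on S (\<lambda>x. infdist x A)"
  by (rule lipschitz_onI) (auto simp: dist_real_def intro: infdist_triangle_abs)

text \<open>Write \<open>d\<close> for the distance to the boundary. Then \<open>sup_norm \<Omega> u = \<bar>u x\<bar> \<le> grad_norm \<Omega> u * d x\<close> because \<open>u\<close> vanishes at the boundary point
  nearest to \<open>x\<close>, while minimality of \<open>u\<close> against the competitor \<open>d\<close>, whose Rayleigh quotient is at most
  \<open>1 / d y\<close>, gives \<open>grad_norm \<Omega> u * d y \<le> sup_norm \<Omega> u\<close>.\<close>

lemma inradius_le_at_maximum:
  fixes u :: "'a::euclidean_space \<Rightarrow> real"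
  assumes \<Omega>: "open \<Omega>" "bounded \<Omega>" "frontier \<Omega> \<noteq> {}"
    and u: "u \<in> Lip0_nonzero \<Omega>"
    and u_min: "\<And>v. v \<in> Lip0_nonzero \<Omega> \<Longrightarrow> rayleigh \<Omega> u \<le> rayleigh \<Omega> v"
    and x: "x \<in> omega_max \<Omega> u" and y: "y \<in> \<Omega>"
  shows "infdist y (frontier \<Omega>) \<le> infdist x (frontier \<Omega>)"
proof -
  let ?d = "\<lambda>x. infdist x (frontier \<Omega>)"
  have u': "u \<in> Lip \<Omega>" "\<And>z. z \<in> frontier \<Omega> \<Longrightarrow> u z = 0"
    using u by (auto simp: Lip0_nonzero_def Lip0_def)
  have x': "x \<in> \<Omega>" "\<bar>u x\<bar> = sup_norm \<Omega> u"
    using x by (auto simp: omega_max_def)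
  have lip: "1-lipschitz_on (closure \<Omega>) ?d" by (rule infdist_lipschitz)
  then have dL: "?d \<in> Lip \<Omega>" by (auto simp: Lip_def)
  have dpos: "?d y > 0"
    using infdist_frontier_pos[OF \<Omega>(1) y \<Omega>(3)] .
  then have d: "?d \<in> Lip0_nonzero \<Omega>"
    using dL y by (auto simp: Lip0_nonzero_def Lip0_def intro!: bexI[of _ y])
  have sd: "?d y \<le> sup_norm \<Omega> ?d"
    using abs_le_sup_norm[OF \<Omega>(2) dL, of y] y closure_subset[of \<Omega>] by auto
  obtain z where "z \<in> \<Omega>" "u z \<noteq> 0"
    using u by (auto simp: Lip0_nonzero_def)
  then have su: "sup_norm \<Omega> u > 0"
    using abs_le_sup_norm[OF \<Omega>(2) u'(1), of z] closure_subset[of \<Omega>] by force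
  have gd: "grad_norm \<Omega> ?d \<le> 1"
    using grad_norm_le[OF \<Omega>(1) _ lip] y by blast
  have "grad_norm \<Omega> u / sup_norm \<Omega> u \<le> grad_norm \<Omega> ?d / sup_norm \<Omega> ?d"
    using u_min[OF d] by (simp add: rayleigh_def)
  also have "\<dots> \<le> 1 / ?d y"
    using gd sd dpos by (intro frac_le) auto
  finally have 1: "grad_norm \<Omega> u * ?d y \<le> sup_norm \<Omega> u"
    using su dpos by (simp add: field_simps)
  obtain b where b: "b \<in> frontier \<Omega>" "?d x = dist x b"
    using infdist_attains_inf[OF frontier_closed \<Omega>(3)] by metis
  have "sup_norm \<Omega> u \<le> grad_norm \<Omega> u * ?d x"
    using increment_le_grad_norm[OF \<Omega>(1,3) u'(1) x'(1), of b] b u'(2)[OF b(1)] x'(2) by simp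
  moreover from this have "grad_norm \<Omega> u > 0"
    using su infdist_frontier_pos[OF \<Omega>(1) x'(1) \<Omega>(3)] by (meson less_le_trans zero_less_mult_pos2)
  ultimately show ?thesis
    using 1 by (meson mult_le_cancel_left_pos order_trans)
qed

lemma sets_omega_max:
  fixes u :: "'a::euclidean_space \<Rightarrow> real"
  assumes \<Omega>: "open \<Omega>" and u: "u \<in> Lip \<Omega>"
  shows "omega_max \<Omega> u \<in> sets borel"
proof -
  obtain L where L: "L-lipschitz_on (closure \<Omega>) u"
    using u by (auto simp: Lip_def)
  obtain h where h: "L-lipschitz_on UNIV h" "\<And>x. x \<in> closure \<Omega> \<Longrightarrow> h x = u x"
    using lipschitz_on_extension[OF L] by blast
  have [measurable]: "h \<in> borel_measurable borel"
    using lipschitz_on_continuous_on[OF h(1)] by (rule borel_measurable_continuous_onI)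
  have "omega_max \<Omega> u = \<Omega> \<inter> {x. \<bar>h x\<bar> = sup_norm \<Omega> u}"
    using h(2) closure_subset[of \<Omega>] by (auto simp: omega_max_def subset_iff)
  also have "\<dots> \<in> sets borel"
    using \<Omega> by measurable
  finally show ?thesis .
qed

section \<open>Transport to the boundary\<close>

text \<open>The distance to the boundary is an admissible test function in the supremum that defines \<open>W1\<close>, and its
  integral against a boundary measure vanishes.\<close>

lemma W1_boundary_lower_bound:
  fixes \<Omega> :: "'a::euclidean_space set"
  assumes \<Omega>: "open \<Omega>" "bounded \<Omega>" "\<Omega> \<noteq> {}"
    and \<mu>: "\<mu> \<in> prob_measures_on \<Omega>" and \<delta>: "\<delta> \<in> prob_measures_on (frontier \<Omega>)"
    and R: "AE x in \<mu>. R \<le> infdist x (frontier \<Omega>)"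
  shows "ereal R \<le> W1 \<Omega> \<mu> \<delta>"
proof -
  let ?d = "\<lambda>x. infdist x (frontier \<Omega>)"
  have lip: "1-lipschitz_on (closure \<Omega>) ?d" by (rule infdist_lipschitz)
  then have d: "?d \<in> Lip \<Omega>" "grad_norm \<Omega> ?d \<le> 1"
    using grad_norm_le[OF \<Omega>(1,3) lip] by (auto simp: Lip_def)
  have fm: "sets \<mu> = sets borel" "prob_space \<mu>" "emeasure \<mu> (- \<Omega>) = 0"
      "sets \<delta> = sets borel" "prob_space \<delta>" "emeasure \<delta> (- frontier \<Omega>) = 0"
    using \<mu> \<delta> by (auto simp: prob_measures_on_def finite_measures_on_def)
  have "- \<Omega> \<in> null_sets \<mu>"
    using fm \<Omega>(1) by (auto simp: null_sets_def)
  from AE_not_in[OF this] R have "AE x in \<mu>. R \<le> indicator (closure \<Omega>) x *\<^sub>R ?d x"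
    by eventually_elim (use closure_subset[of \<Omega>] in \<open>auto simp: indicator_def\<close>)
  then have 1: "R \<le> (LINT x:closure \<Omega>|\<mu>. ?d x)"
    using set_integrable_Lip[OF \<Omega>(2) d(1) fm(1)] fm(2) unfolding set_lebesgue_integral_def set_integrable_def
    by (intro prob_space.integral_ge_const) (auto simp: prob_space.finite_measure prob_space_def)
  have "- frontier \<Omega> \<in> null_sets \<delta>"
    using fm frontier_closed[of \<Omega>] by (auto simp: null_sets_def)
  from AE_not_in[OF this] have "AE x in \<delta>. indicator (closure \<Omega>) x *\<^sub>R ?d x = 0"
    by eventually_elim auto
  then have 2: "(LINT x:closure \<Omega>|\<delta>. ?d x) = 0"
    unfolding set_lebesgue_integral_def by (rule integral_eq_zero_AE)
  have "ereal ((LINT x:closure \<Omega>|\<mu>. ?d x) - (LINT x:closure \<Omega>|\<delta>. ?d x)) \<le> W1 \<Omega> \<mu> \<delta>"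
    unfolding W1_def using d by (intro SUP_upper) auto
  then show ?thesis
    using 1 2 by (auto intro: order_trans[rotated])
qed

text \<open>The boundary measure is the image of \<open>\<mu>\<close> under a map \<open>p\<close> to nearly nearest boundary points. A point \<open>x\<close> is sent
  to a nearest boundary point of the first member of a dense sequence that is \<open>\<epsilon>\<close>-close to \<open>x\<close>; such
  a \<open>p\<close> takes countably many values, which avoids a measurable selection of nearest points.\<close>

lemma W1_boundary_upper_bound:
  fixes \<Omega> :: "'a::euclidean_space set"
  assumes \<Omega>: "open \<Omega>" "bounded \<Omega>" "\<Omega> \<noteq> {}" "frontier \<Omega> \<noteq> {}"
    and \<mu>: "\<mu> \<in> prob_measures_on \<Omega>"
    and R: "\<And>x. x \<in> \<Omega> \<Longrightarrow> infdist x (frontier \<Omega>) \<le> R" and \<epsilon>: "0 < \<epsilon>"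
  obtains \<delta> where "\<delta> \<in> prob_measures_on (frontier \<Omega>)" "W1 \<Omega> \<mu> \<delta> \<le> ereal (R + \<epsilon>)"
proof -
  let ?d = "\<lambda>x. infdist x (frontier \<Omega>)"
  have \<mu>': "sets \<mu> = sets borel" "prob_space \<mu>" "emeasure \<mu> (- \<Omega>) = 0"
    using \<mu> by (auto simp: prob_measures_on_def finite_measures_on_def)
  interpret \<mu>: prob_space \<mu> by fact
  obtain T where T: "countable T" "T \<subseteq> \<Omega>" "\<Omega> \<subseteq> closure T"
    using separable[of \<Omega>] by blast
  have "T \<noteq> {}" using T(3) \<Omega>(3) by auto
  define c where "c = from_nat_into T"
  have c: "c i \<in> \<Omega>" for i
    using from_nat_into[OF \<open>T \<noteq> {}\<close>] T(2) by (auto simp: c_def)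
  have "\<forall>x. \<exists>y\<in>frontier \<Omega>. ?d x = dist x y"
    using infdist_attains_inf[OF frontier_closed \<Omega>(4)] by metis
  then obtain q where q: "\<And>x. q x \<in> frontier \<Omega>" "\<And>x. ?d x = dist x (q x)"
    by metis
  \<comment> \<open>The second condition places \<open>c i\<close> in the ball around \<open>x\<close> on which increments are controlled.\<close>
  define near where "near i x \<longleftrightarrow> dist x (c i) < \<epsilon> \<and> dist x (c i) < ?d x" for i x
  define ix where "ix x = (LEAST i. near i x)" for x
  define p where "p x = q (c (ix x))" for x
  have "Measurable.pred borel (near i)" for i
  proof -
    have [measurable]: "?d \<in> borel_measurable borel"
      by (intro borel_measurable_continuous_onI continuous_on_infdist continuous_on_id)
    show ?thesis
      unfolding near_def by measurable
  qed
  then have ix: "ix \<in> borel \<rightarrow>\<^sub>M count_space UNIV"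
    unfolding ix_def by (rule measurable_Least)
  have p: "p \<in> borel_measurable borel"
    unfolding p_def by (rule measurable_compose[OF ix]) simp
  then have p\<mu>: "p \<in> borel_measurable \<mu>"
    using measurable_cong_sets[OF \<mu>'(1) refl] by blast
  have near: "near (ix x) x" if "x \<in> \<Omega>" for x
  proof -
    have "0 < min \<epsilon> (?d x)"
      using \<epsilon> infdist_frontier_pos[OF \<Omega>(1) that \<Omega>(4)] by simp
    then have "\<exists>y\<in>T. dist y x < min \<epsilon> (?d x)"
      using T(3) that closure_approachable by blast
    then obtain i where "dist (c i) x < min \<epsilon> (?d x)"
      using from_nat_into_surj[OF T(1)] unfolding c_def by metis
    then have "near i x"
      by (simp add: near_def dist_commute)
    then show ?thesis
      unfolding ix_def by (rule LeastI[where P="\<lambda>i. near i x"])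
  qed
  define \<delta> where "\<delta> = distr \<mu> borel p"
  have "prob_space \<delta>"
    unfolding \<delta>_def using p\<mu> by (rule \<mu>.prob_space_distr)
  moreover have "p -` (- frontier \<Omega>) = {}"
    using q(1) by (auto simp: p_def)
  then have "emeasure \<delta> (- frontier \<Omega>) = 0"
    unfolding \<delta>_def using frontier_closed[of \<Omega>] by (subst emeasure_distr[OF p\<mu>]) auto
  ultimately have \<delta>: "\<delta> \<in> prob_measures_on (frontier \<Omega>)"
    by (auto simp: prob_measures_on_def finite_measures_on_def \<delta>_def prob_space_def)
  have "(LINT x:closure \<Omega>|\<mu>. u x) - (LINT x:closure \<Omega>|\<delta>. u x) \<le> R + \<epsilon>"
    if u: "u \<in> Lip \<Omega>" "grad_norm \<Omega> u \<le> 1" for u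
  proof -
    define w where "w x = indicator (closure \<Omega>) x *\<^sub>R u x" for x
    have w\<mu>: "integrable \<mu> w" and w\<delta>: "integrable \<delta> w"
      using set_integrable_Lip[OF \<Omega>(2) u(1)] \<mu>' \<mu>.finite_measure_axioms \<open>prob_space \<delta>\<close>
      by (auto simp: w_def[abs_def] set_integrable_def \<delta>_def prob_space_def)
    have w_meas: "w \<in> borel_measurable borel"
      using borel_measurable_integrable[OF w\<mu>] measurable_cong_sets[OF \<mu>'(1) refl] by blast
    have wp: "integrable \<mu> (\<lambda>x. w (p x))"
      using w\<delta> unfolding \<delta>_def by (rule integrable_distr[OF p\<mu>])
    have eq: "(LINT x:closure \<Omega>|\<mu>. u x) - (LINT x:closure \<Omega>|\<delta>. u x) = (\<integral>x. w x - w (p x) \<partial>\<mu>)"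
      unfolding set_lebesgue_integral_def w_def[symmetric] \<delta>_def integral_distr[OF p\<mu> w_meas]
      by (rule Bochner_Integration.integral_diff[OF w\<mu> wp, symmetric])
    have "w x - w (p x) \<le> R + \<epsilon>" if x: "x \<in> \<Omega>" for x
    proof -
      let ?c = "c (ix x)"
      have n: "dist x ?c < \<epsilon>" "dist x ?c < ?d x"
        using near[OF x] by (auto simp: near_def)
      have "\<bar>u ?c - u x\<bar> \<le> grad_norm \<Omega> u * dist x ?c"
        using n by (intro increment_le_grad_norm \<Omega> u x) auto
      also have "\<dots> \<le> 1 * dist x ?c"
        using u(2) by (intro mult_right_mono) auto
      finally have 1: "\<bar>u ?c - u x\<bar> \<le> \<epsilon>" using n by simp
      have "\<bar>u (q ?c) - u ?c\<bar> \<le> grad_norm \<Omega> u * dist ?c (q ?c)"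
        by (intro increment_le_grad_norm \<Omega> u c) (simp add: q(2))
      also have "\<dots> \<le> 1 * dist ?c (q ?c)"
        using u(2) by (intro mult_right_mono) auto
      finally have 2: "\<bar>u (q ?c) - u ?c\<bar> \<le> R"
        using R[OF c, of "ix x"] q(2)[of ?c] by simp
      have "x \<in> closure \<Omega>" "q ?c \<in> closure \<Omega>"
        using x closure_subset q(1) by (auto simp: frontier_def)
      then show ?thesis
        using 1 2 by (simp add: w_def p_def)
    qed
    moreover have "- \<Omega> \<in> null_sets \<mu>"
      using \<mu>' \<Omega>(1) by (auto simp: null_sets_def)
    from AE_not_in[OF this] have "AE x in \<mu>. x \<in> \<Omega>" by simp
    ultimately have "AE x in \<mu>. w x - w (p x) \<le> R + \<epsilon>"
      by (auto elim: eventually_mono)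
    then show ?thesis
      unfolding eq by (intro \<mu>.integral_le_const Bochner_Integration.integrable_diff w\<mu> wp)
  qed
  then have "W1 \<Omega> \<mu> \<delta> \<le> ereal (R + \<epsilon>)"
    unfolding W1_def by (intro SUP_least) auto
  with \<delta> show ?thesis by (rule that)
qed

theorem proposition4p6:
  fixes \<Omega> :: "(real ^ 'n) set"
    and u :: "real ^ 'n \<Rightarrow> real"
    and U :: "nat \<Rightarrow> real ^ 'n \<Rightarrow> real"
    and \<nu> \<tau> :: "(real ^ 'n) measure"
    and g :: "real ^ 'n \<Rightarrow> real ^ 'n"
    and \<sigma> :: "(real ^ 'n) set \<Rightarrow> real ^ 'n"
  assumes domain: "open \<Omega>" "connected \<Omega>" "\<Omega> \<noteq> {}" "bounded \<Omega>"
    and u_mem: "u \<in> Lip0_nonzero \<Omega>"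
    and u_min: "\<And>v. v \<in> Lip0_nonzero \<Omega> \<Longrightarrow> rayleigh \<Omega> u \<le> rayleigh \<Omega> v"
    and nu: "\<nu> \<in> finite_measures_on \<Omega>"
    and tau: "\<tau> \<in> finite_measures_on \<Omega>"
    and tangential: "is_tangential_gradient \<Omega> \<tau> u g"
    and sigma: "\<sigma> = (\<lambda>A. LINT x:A|\<tau>. g x)"
    and equation: "has_divergence \<Omega> \<sigma> (\<lambda>A. - (lambda_inf \<Omega> * (LINT x:A \<inter> \<Omega>|\<nu>. u x)))"
    and nu_mass: "measure \<nu> \<Omega> = 1 / sup_norm \<Omega> u"
    and tau_mass: "measure \<tau> \<Omega> = 1 / grad_norm \<Omega> u"
    and nu_supp: "emeasure \<nu> (\<Omega> - omega_max \<Omega> u) = 0"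
    and approx: "approx_seq \<Omega> u U"
    and tau_supp: "emeasure \<tau> (\<Omega> - Omega_max \<Omega> u U) = 0"
    and pairing: "is_pairing \<Omega> u \<sigma> (\<lambda>A. grad_norm \<Omega> u * total_variation \<sigma> A)"
  shows "is_arg_max (\<lambda>\<mu>. INF \<delta>\<in>prob_measures_on (frontier \<Omega>). W1 \<Omega> \<mu> \<delta>)
           (\<lambda>\<mu>. \<mu> \<in> prob_measures_on \<Omega>)
           (scale_measure (ennreal (sup_norm \<Omega> u)) \<nu>)"
proof -
  let ?d = "\<lambda>x. infdist x (frontier \<Omega>)"
  define \<mu> where "\<mu> = scale_measure (ennreal (sup_norm \<Omega> u)) \<nu>"
  have fr: "frontier \<Omega> \<noteq> {}"
    using domain by (metis frontier_eq_empty not_bounded_UNIV)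
  have uL: "u \<in> Lip \<Omega>"
    using u_mem by (auto simp: Lip0_nonzero_def Lip0_def)
  obtain z where "z \<in> \<Omega>" "u z \<noteq> 0"
    using u_mem by (auto simp: Lip0_nonzero_def)
  then have su: "sup_norm \<Omega> u > 0"
    using abs_le_sup_norm[OF domain(4) uL, of z] closure_subset[of \<Omega>] by force
  have \<nu>: "sets \<nu> = sets borel" "finite_measure \<nu>" "emeasure \<nu> (- \<Omega>) = 0"
    using nu by (auto simp: finite_measures_on_def)
  have sets: "sets \<mu> = sets borel" and space: "space \<mu> = UNIV"
    using \<nu>(1) sets_eq_imp_space_eq[OF \<nu>(1)] by (simp_all add: \<mu>_def space_scale_measure)
  have "emeasure \<nu> UNIV = emeasure \<nu> \<Omega> + emeasure \<nu> (- \<Omega>)"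
    using plus_emeasure[of \<Omega> \<nu> "- \<Omega>"] domain(1) \<nu>(1) by simp
  also have "\<dots> = ennreal (1 / sup_norm \<Omega> u)"
    using \<nu>(3) nu_mass by (simp add: finite_measure.emeasure_eq_measure[OF \<nu>(2)])
  finally have "emeasure \<mu> (space \<mu>) = 1"
    using su space by (simp add: \<mu>_def ennreal_mult[symmetric])
  then have prob: "prob_space \<mu>" by (rule prob_spaceI)
  then have \<mu>: "\<mu> \<in> prob_measures_on \<Omega>"
    using sets \<nu>(3) by (simp add: prob_measures_on_def finite_measures_on_def \<mu>_def prob_space_def)

  \<comment> \<open>The measure sits on \<open>omega_max\<close>, all of whose points have the same, maximal distance \<open>R\<close> to the boundary.\<close>
  have null: "- \<Omega> \<in> null_sets \<mu>" "\<Omega> - omega_max \<Omega> u \<in> null_sets \<mu>"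
    using sets \<nu> nu_supp domain(1) sets_omega_max[OF domain(1) uL]
    by (auto simp: null_sets_def \<mu>_def)
  have AE: "AE x in \<mu>. x \<in> omega_max \<Omega> u"
    using AE_not_in[OF null(1)] AE_not_in[OF null(2)] by eventually_elim auto
  then obtain x0 where x0: "x0 \<in> omega_max \<Omega> u"
    using prob_space.not_empty[OF prob] prob_space.AE_False[OF prob]
    by (metis (mono_tags, lifting) eventually_mono)
  define R where "R = ?d x0"
  have deepest: "?d y \<le> ?d x" if "x \<in> omega_max \<Omega> u" "y \<in> \<Omega>" for x y
    by (rule inradius_le_at_maximum[OF domain(1,4) fr u_mem _ that]) (rule u_min)
  have le_R: "?d x \<le> R" if "x \<in> \<Omega>" for x
    using deepest[OF x0 that] by (simp add: R_def)
  have "x0 \<in> \<Omega>" using x0 by (simp add: omega_max_def)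
  then have "AE x in \<mu>. R \<le> ?d x"
    using AE by (auto elim!: eventually_mono simp: R_def intro: deepest)
  then have lower: "ereal R \<le> (INF \<delta>\<in>prob_measures_on (frontier \<Omega>). W1 \<Omega> \<mu> \<delta>)"
    using W1_boundary_lower_bound[OF domain(1,4,3) \<mu>] by (intro INF_greatest) auto
  have upper: "(INF \<delta>\<in>prob_measures_on (frontier \<Omega>). W1 \<Omega> \<mu>' \<delta>) \<le> ereal R"
    if \<mu>': "\<mu>' \<in> prob_measures_on \<Omega>" for \<mu>'
  proof (rule ereal_le_epsilon2)
    fix \<epsilon> :: real assume "0 < \<epsilon>"
    then obtain \<delta> where "\<delta> \<in> prob_measures_on (frontier \<Omega>)" "W1 \<Omega> \<mu>' \<delta> \<le> ereal (R + \<epsilon>)"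
      using W1_boundary_upper_bound[OF domain(1,4,3) fr \<mu>' le_R] by blast
    then show "(INF \<delta>\<in>prob_measures_on (frontier \<Omega>). W1 \<Omega> \<mu>' \<delta>) \<le> ereal R + ereal \<epsilon>"
      by (auto intro: INF_lower2)
  qed
  show ?thesis
    unfolding is_arg_max_def \<mu>_def[symmetric]
    using \<mu> lower upper by (auto simp: not_less intro: order_trans)
qed

end
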